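(* The irregular locus $\mathcal{B}_X:=\mathcal{W}_X\setminus\mathcal{W}_X^0$ is closed in $\operatorname{Hom}(V,W)$, and the complement $\operatorname{Hom}(V,W)\setminus\mathcal{B}_X$ is connected.
   Context: $V$ is a real vector space of finite dimension $N$, $\mathbb{P}(V)$ is the projective space of lines in $V$, $X\subset\mathbb{P}(V)$ is a compact smooth (not necessarily algebraic) submanifold of dimension $m<N-1$, $n:=m+1$, and $W$ is a real vector space of dimension $n$. $Y_X\subset X\times V$ is the rank $n$ subbundle whose fibre $Y_l$ at a line $l\in X$ contains $l$ and is such that, under $T_l\mathbb{P}(V)=\operatorname{Hom}(l,V/l)$, one has $T_lX=\operatorname{Hom}(l,Y_l/l)$. The wall is $\mathcal{W}_X:=\{f\in\operatorname{Hom}(V,W)\mid X\cap\mathbb{P}(\ker f)\neq\emptyset\}$. A point $f\in\mathcal{W}_X$ is called regular if $f$ is surjective, $X\cap\mathbb{P}(\ker f)$ consists of a single point $\xi_f$, and $\ker(f)\cap Y_{\xi_f}=\xi_f$. $\mathcal{W}_X^0$ is the set of regular points of the wall. *)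

theory Defs
  imports "HOL-Analysis.Analysis"
begin

text \<open>
  Real vector spaces of finite positive dimension are rendered as types of class
  \<open>euclidean_space\<close>.  No definition below uses the inner product; the norm enters only through the
  topology and the derivatives it induces, which do not depend on its choice.
\<close>

section \<open>Smooth maps and submanifolds of a finite-dimensional vector space\<close>

text \<open>Used for open sets \<open>S\<close> only, where it is the usual condition \<open>f \<in> C\<^sup>k(S)\<close>.\<close>

primrec Ck_on ::
  "nat \<Rightarrow> 'a::euclidean_space set \<Rightarrow> ('a \<Rightarrow> 'b::euclidean_space) \<Rightarrow> bool" where
  "Ck_on 0 S f \<longleftrightarrow> continuous_on S f"
| "Ck_on (Suc k) S f \<longleftrightarrow>
     (\<forall>x\<in>S. f differentiable (at x)) \<and> (\<forall>v. Ck_on k S (\<lambda>x. frechet_derivative f (at x) v))"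

definition smooth_on :: "'a::euclidean_space set \<Rightarrow> ('a \<Rightarrow> 'b::euclidean_space) \<Rightarrow> bool" where
  "smooth_on S f \<longleftrightarrow> (\<forall>k. Ck_on k S f)"

text \<open>Embedded submanifolds of pure dimension \<open>m\<close> without boundary, by slice charts.\<close>

definition smooth_submanifold :: "nat \<Rightarrow> 'a::euclidean_space set \<Rightarrow> bool" where
  "smooth_submanifold m S \<longleftrightarrow>
     (\<forall>p\<in>S. \<exists>U U' E \<phi> \<psi>.
        open U \<and> p \<in> U \<and> open U' \<and>
        homeomorphism U U' \<phi> \<psi> \<and> smooth_on U (\<phi> :: 'a \<Rightarrow> 'a) \<and> smooth_on U' (\<psi> :: 'a \<Rightarrow> 'a) \<and>
        subspace E \<and> dim E = m \<and> \<phi> ` (U \<inter> S) = U' \<inter> E)"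


section \<open>Projective space\<close>

text \<open>\<open>proj K\<close> is the set of lines contained in the linear subspace \<open>K\<close>.\<close>

definition proj :: "'v::euclidean_space set \<Rightarrow> 'v set set" where
  "proj K = {l. subspace l \<and> dim l = 1 \<and> l \<subseteq> K}"

definition proj_topology :: "'v::euclidean_space set topology" where
  "proj_topology = topology (\<lambda>U. U \<subseteq> proj UNIV \<and> open {v. v \<noteq> 0 \<and> span {v} \<in> U})"

lemma openin_proj_topology:
  "openin proj_topology U \<longleftrightarrow> U \<subseteq> proj UNIV \<and> open {v. v \<noteq> 0 \<and> span {v} \<in> U}"
proof -
  define P where "P = (\<lambda>U. U \<subseteq> proj UNIV \<and> open {v::'a. v \<noteq> 0 \<and> span {v} \<in> U})"
  have "P (S \<inter> T)" if "P S" "P T" for S T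
  proof -
    have "{v. v \<noteq> 0 \<and> span {v} \<in> S \<inter> T} =
      {v. v \<noteq> 0 \<and> span {v} \<in> S} \<inter> {v. v \<noteq> 0 \<and> span {v} \<in> T}" by blast
    moreover have "open ({v. v \<noteq> 0 \<and> span {v} \<in> S} \<inter> {v. v \<noteq> 0 \<and> span {v} \<in> T})"
      using that unfolding P_def by (intro open_Int) (elim conjE, assumption)+
    moreover have "S \<inter> T \<subseteq> proj UNIV" using that unfolding P_def by blast
    ultimately show ?thesis unfolding P_def by (simp only: simp_thms)
  qed
  moreover have "P (\<Union>\<K>)" if K: "\<forall>S\<in>\<K>. P S" for \<K>
  proof -
    have "{v. v \<noteq> 0 \<and> span {v} \<in> \<Union>\<K>} = (\<Union>S\<in>\<K>. {v. v \<noteq> 0 \<and> span {v} \<in> S})" by blast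
    moreover have "open (\<Union>S\<in>\<K>. {v. v \<noteq> 0 \<and> span {v} \<in> S})"
      using K unfolding P_def by (intro open_UN) blast
    moreover have "\<Union>\<K> \<subseteq> proj UNIV" using K unfolding P_def by blast
    ultimately show ?thesis unfolding P_def by (simp only: simp_thms)
  qed
  ultimately have "istopology P"
    unfolding istopology_def by blast
  then show ?thesis
    unfolding proj_topology_def P_def[symmetric] by (simp add: P_def)
qed

lemma span_in_proj: "v \<noteq> 0 \<Longrightarrow> span {v} \<in> proj UNIV"
  by (simp add: proj_def dim_singleton)

lemma proj_eq_span:
  assumes "l \<in> proj UNIV"
  obtains v where "v \<noteq> 0" "l = span {v}"
proof -
  from assms have l: "subspace l" "dim l = 1" by (auto simp: proj_def)
  obtain B where B: "B \<subseteq> l" "independent B" "l \<subseteq> span B" "card B = dim l"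
    by (metis basis_exists)
  with l obtain v where v: "B = {v}" by (metis card_1_singletonE)
  have "l = span {v}" using B l v by (metis span_subspace)
  moreover have "v \<noteq> 0" using B(2) v by (metis dependent_single)
  ultimately show ?thesis using that by blast
qed

lemma topspace_proj_topology: "topspace proj_topology = proj UNIV"
proof
  show "topspace proj_topology \<subseteq> (proj UNIV :: 'a set set)"
    using openin_topspace openin_proj_topology by blast
  have "{v::'a. v \<noteq> 0 \<and> span {v} \<in> proj UNIV} = UNIV - {0}"
    using span_in_proj by blast
  then have "openin proj_topology (proj UNIV :: 'a set set)"
    unfolding openin_proj_topology using open_delete[OF open_UNIV] by simp
  then show "(proj UNIV :: 'a set set) \<subseteq> topspace proj_topology"
    by (rule openin_subset)
qed

lemma quotient_map_proj_topology:
  "quotient_map (top_of_set (UNIV - {0})) proj_topology (\<lambda>v. span {v})"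
proof -
  have surj: "(\<lambda>v::'a. span {v}) ` (UNIV - {0}) = proj UNIV"
  proof
    show "(\<lambda>v::'a. span {v}) ` (UNIV - {0}) \<subseteq> proj UNIV"
      using span_in_proj by fast
    show "proj UNIV \<subseteq> (\<lambda>v::'a. span {v}) ` (UNIV - {0})"
    proof
      fix l :: "'a set" assume "l \<in> proj UNIV"
      then obtain v where "v \<noteq> 0" "l = span {v}" by (rule proj_eq_span)
      then show "l \<in> (\<lambda>v. span {v}) ` (UNIV - {0})" by (intro image_eqI) simp_all
    qed
  qed
  have op: "openin (top_of_set (UNIV - {0::'a})) {v \<in> UNIV - {0}. span {v} \<in> U}
      \<longleftrightarrow> open {v::'a. v \<noteq> 0 \<and> span {v} \<in> U}" for U
  proof -
    have "openin (top_of_set (UNIV - {0::'a})) S \<longleftrightarrow> open S \<and> S \<subseteq> UNIV - {0}" for S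
      by (rule openin_open_eq) (rule open_delete[OF open_UNIV])
    moreover have "{v \<in> UNIV - {0}. span {v} \<in> U} = {v::'a. v \<noteq> 0 \<and> span {v} \<in> U}" by simp
    ultimately show ?thesis by auto
  qed
  show ?thesis
    unfolding quotient_map_def topspace_proj_topology openin_proj_topology
      topspace_euclidean_subtopology
    using surj op by simp
qed

text \<open>
  The affine charts of projective space: for a linear form \<open>\<alpha> \<noteq> 0\<close>, the map \<open>v \<mapsto> span {v}\<close>
  identifies the affine hyperplane \<open>\<alpha> = 1\<close> with the open set of all lines not contained in the
  kernel of \<open>\<alpha>\<close>.  A set of lines is a submanifold if all its traces in these charts are; being
  an embedded submanifold of the hyperplane is the same as being an embedded submanifold of the
  vector space that lies in the hyperplane.  (For \<open>\<alpha> = 0\<close> the condition is void.)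
\<close>

definition proj_submanifold :: "nat \<Rightarrow> 'v::euclidean_space set set \<Rightarrow> bool" where
  "proj_submanifold m X \<longleftrightarrow>
     X \<subseteq> proj UNIV \<and>
     (\<forall>\<alpha> :: 'v \<Rightarrow> real. linear \<alpha> \<longrightarrow> smooth_submanifold m {v. \<alpha> v = 1 \<and> span {v} \<in> X})"


section \<open>Tangent spaces\<close>

text \<open>
  \<open>quot_hom l Y\<close> is \<open>Hom(l, Y/l)\<close> for subspaces \<open>l \<subseteq> Y\<close>: its elements are functions on \<open>l\<close>
  (with the dummy value \<open>undefined\<close> outside \<open>l\<close>) whose values are cosets \<open>w + l\<close>, \<open>w \<in> Y\<close>.
  Linearity is expressed on representatives of the cosets.
\<close>

definition quot_hom :: "'v::real_vector set \<Rightarrow> 'v set \<Rightarrow> ('v \<Rightarrow> 'v set) set" where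
  "quot_hom l Y =
     {h \<in> l \<rightarrow>\<^sub>E (\<lambda>w. (+) w ` l) ` Y.
        \<forall>x\<in>l. \<forall>y\<in>l. \<forall>a b. \<forall>u\<in>h x. \<forall>w\<in>h y. a *\<^sub>R u + b *\<^sub>R w \<in> h (a *\<^sub>R x + b *\<^sub>R y)}"

text \<open>
  The tangent space of \<open>X\<close> at \<open>l\<close>, as the set of velocities at time \<open>0\<close> of smooth curves in \<open>X\<close>,
  viewed inside \<open>T\<^sub>l P(V) = Hom(l, V/l)\<close>.  A smooth curve of lines is written as
  \<open>t \<mapsto> span {\<gamma> t}\<close> with a smooth nowhere vanishing lift \<open>\<gamma>\<close>, and its velocity is the homomorphism
  that sends \<open>\<gamma> 0\<close> to the class of \<open>\<gamma>'(0)\<close>; this does not depend on the lift.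
\<close>

definition proj_tangent_space :: "'v::euclidean_space set set \<Rightarrow> 'v set \<Rightarrow> ('v \<Rightarrow> 'v set) set" where
  "proj_tangent_space X l =
     {h \<in> quot_hom l UNIV. \<exists>e \<gamma>. e > 0 \<and> smooth_on {-e<..<e} \<gamma> \<and>
        (\<forall>t\<in>{-e<..<e}. \<gamma> t \<noteq> 0 \<and> span {\<gamma> t} \<in> X) \<and> span {\<gamma> 0} = l \<and>
        h (\<gamma> 0) = (+) (vector_derivative \<gamma> (at (0::real))) ` l}"

definition tangent_fibre :: "'v::euclidean_space set set \<Rightarrow> 'v set \<Rightarrow> 'v set" where
  "tangent_fibre X l = (THE Y. subspace Y \<and> l \<subseteq> Y \<and> proj_tangent_space X l = quot_hom l Y)"


section \<open>The wall\<close>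

text \<open>
  Every linear map between the spaces considered is bounded, so the type of bounded linear maps
  is all of \<open>Hom(V, W)\<close>, and the operator norm induces its usual topology.
\<close>

definition kernel :: "('v::euclidean_space \<Rightarrow>\<^sub>L 'w::euclidean_space) \<Rightarrow> 'v set" where
  "kernel f = {v. blinfun_apply f v = 0}"

definition wall :: "'v::euclidean_space set set \<Rightarrow> ('v \<Rightarrow>\<^sub>L 'w::euclidean_space) set" where
  "wall X = {f. X \<inter> proj (kernel f) \<noteq> {}}"

definition regular_wall :: "'v::euclidean_space set set \<Rightarrow> ('v \<Rightarrow>\<^sub>L 'w::euclidean_space) set" where
  "regular_wall X =
     {f \<in> wall X. surj (blinfun_apply f) \<and>
        (\<exists>\<xi>. X \<inter> proj (kernel f) = {\<xi>} \<and> kernel f \<inter> tangent_fibre X \<xi> = \<xi>)}"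

definition irregular_locus :: "'v::euclidean_space set set \<Rightarrow> ('v \<Rightarrow>\<^sub>L 'w::euclidean_space) set" where
  "irregular_locus X = wall X - regular_wall X"

end

theory Submission
  imports Defs
begin

text \<open>
  A map \<open>f\<close> on the wall fails to be regular for one of three reasons: it is not surjective, its
  kernel contains two distinct lines of \<open>X\<close>, or its kernel contains a line \<open>l \<in> X\<close> together with a
  further direction of \<open>Y\<^sub>l\<close>.  The second and the third case are the secants and the tangents of \<open>X\<close>,
  and the whole proof treats them side by side.

  Connectedness.  With \<open>N = dim V\<close> and \<open>n = m + 1 = dim W < N\<close>, a parameter count shows that each of
  the three sets has codimension at least 2 in \<open>Hom(V, W)\<close>.  A map that is not surjective is
  determined by a point of the projective space of \<open>W\<^sup>*\<close> and by \<open>n - 1\<close> linear forms on \<open>V\<close>, that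
  is by \<open>(n - 1) + N (n - 1) \<le> N n - 2\<close> parameters.  A secant or a tangent vector depends on \<open>2m\<close>
  parameters, and a map that vanishes on a given plane on \<open>n (N - 2)\<close>, which makes
  \<open>2m + n (N - 2) = N n - 2\<close>.  The cone over such a set from any apex is then a countable union of
  differentiable images of sets of dimension less than \<open>N n\<close>, hence is Lebesgue negligible.  So for
  two maps outside the irregular locus almost every \<open>g\<close> lies on neither of the two cones, and the
  broken segment through \<open>g\<close> joins them in the complement
  (\<open>connected_complement_cone_negligible\<close>, \<open>cone_negligible_not_surj\<close>,
  \<open>cone_negligible_kill_two_vectors\<close>, \<open>cone_negligible_irregular_locus\<close>).

  Closedness.  Because \<open>X\<close> is compact, the wall is closed, and the maps that are not surjective form a
  closed set as well.  If maps whose kernels contain two lines of \<open>X\<close>, or a line and a tangent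
  direction, converge to \<open>f\<close>, then after passing to a subsequence these lines converge.  Either two
  distinct limit lines lie in the kernel of \<open>f\<close>, or everything happens near one line \<open>l\<close>.  In the
  latter case, if \<open>ker f\<close> met \<open>Y\<^sub>l\<close> only in \<open>l\<close>, then \<open>f\<close> composed with a local parametrisation of \<open>X\<close>
  would be an immersion at \<open>l\<close>; immersions are locally injective, uniformly under perturbations that
  are small in the \<open>C\<^sup>1\<close> sense (\<open>immersion_stable\<close>), which contradicts the nearby secants or tangents.

  Both parts need \<open>Y\<^sub>l\<close> in coordinates.  Lines outside a coordinate hyperplane are represented by their
  vector with \<open>i\<close>-th coordinate 1; if \<open>\<psi>\<close> is a slice parametrisation of these vectors and
  \<open>l = span {\<psi> x}\<close>, then \<open>Y\<^sub>l\<close> is spanned by \<open>\<psi> x\<close> and the image of the derivative of \<open>\<psi>\<close> at \<open>x\<close>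
  (\<open>tangent_fibre_eq\<close>).
\<close>

section \<open>Sets avoided by generic broken segments\<close>

text \<open>
  This is how ``codimension at least 2'' enters: a cone raises the dimension by at most one, so a set
  of codimension at least 2 has negligible cones from every apex \<open>a\<close>.  The condition passes to subsets
  and to countable unions, and it spares any notion of dimension for sets that are not submanifolds.
\<close>

definition cone_negligible :: "'a::euclidean_space set \<Rightarrow> bool" where
  "cone_negligible B \<longleftrightarrow> (\<forall>a. negligible {a + s *\<^sub>R (b - a) | s b. b \<in> B})"

lemma cone_negligible_subset:
  assumes "cone_negligible B" "A \<subseteq> B"
  shows "cone_negligible A"
  unfolding cone_negligible_def
proof
  fix a
  have "negligible {a + s *\<^sub>R (b - a) | s b. b \<in> B}"
    using assms(1) by (simp add: cone_negligible_def)
  then show "negligible {a + s *\<^sub>R (b - a) | s b. b \<in> A}"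
    by (rule negligible_subset) (use assms(2) in blast)
qed

lemma cone_negligible_UN:
  assumes "countable I" "\<And>i. i \<in> I \<Longrightarrow> cone_negligible (B i)"
  shows "cone_negligible (\<Union>i\<in>I. B i)"
  unfolding cone_negligible_def
proof
  fix a
  have "negligible (\<Union>i\<in>I. {a + s *\<^sub>R (b - a) | s b. b \<in> B i})"
    using assms by (intro negligible_countable_Union) (auto simp: cone_negligible_def)
  then show "negligible {a + s *\<^sub>R (b - a) | s b. b \<in> (\<Union>i\<in>I. B i)}"
    by (rule negligible_subset) blast
qed

lemma cone_negligible_Un:
  assumes "cone_negligible A" "cone_negligible B"
  shows "cone_negligible (A \<union> B)"
proof -
  have "cone_negligible (\<Union>C\<in>{A, B}. C)"
    using assms by (intro cone_negligible_UN) auto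
  then show ?thesis by simp
qed

text \<open>
  If \<open>g\<close> lies on neither the cone with apex \<open>a\<close> nor the one with apex \<open>b\<close>, then neither of the segments
  from \<open>a\<close> and from \<open>b\<close> to \<open>g\<close> meets \<open>B\<close>: a point of \<open>B\<close> on a segment would put \<open>g\<close> on the cone.
\<close>

lemma connected_complement_cone_negligible:
  fixes B :: "'a::euclidean_space set"
  assumes "cone_negligible B"
  shows "connected (UNIV - B)"
proof -
  have "\<exists>S. connected S \<and> S \<subseteq> UNIV - B \<and> a \<in> S \<and> b \<in> S" if "a \<in> UNIV - B" "b \<in> UNIV - B" for a b
  proof -
    define C where "C c = {c + s *\<^sub>R (b - c) | s b. b \<in> B}" for c
    have "negligible (C a \<union> C b)"
      using assms by (intro negligible_Un) (auto simp: cone_negligible_def C_def)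
    then obtain g where g: "g \<notin> C a" "g \<notin> C b"
      using non_negligible_UNIV[where 'a = 'a] by (metis UNIV_eq_I Un_iff)
    have seg: "closed_segment c g \<subseteq> UNIV - B" if c: "c \<notin> B" and gc: "g \<notin> C c" for c
    proof
      fix x assume xs: "x \<in> closed_segment c g"
      have "x \<notin> B"
      proof
        assume xB: "x \<in> B"
        from xs obtain t where x: "x = c + t *\<^sub>R (g - c)"
          by (auto simp: closed_segment_def algebra_simps)
        have "t \<noteq> 0" using x c xB by auto
        then have "g = c + (1 / t) *\<^sub>R (x - c)" using x by simp
        then show False using gc xB unfolding C_def by blast
      qed
      then show "x \<in> UNIV - B" by simp
    qed
    have "connected (closed_segment a g \<union> closed_segment b g)"
      by (intro connected_Un) auto
    moreover have "closed_segment a g \<union> closed_segment b g \<subseteq> UNIV - B"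
      using seg that g by auto
    moreover have "a \<in> closed_segment a g \<union> closed_segment b g"
      "b \<in> closed_segment a g \<union> closed_segment b g"
      by simp_all
    ultimately show ?thesis by (intro exI conjI)
  qed
  then have "connected_component (UNIV - B) a b" if "a \<in> UNIV - B" "b \<in> UNIV - B" for a b
    using that unfolding connected_component_def by blast
  then show ?thesis
    by (simp add: connected_iff_connected_component)
qed

text \<open>
  Parameter spaces below arise as subspaces of large product types, and only the dimension of the
  subspace matters.  An isometry moves such a subspace into the target space, where it is negligible,
  and differentiable maps between spaces of equal dimension preserve negligible sets.
\<close>

lemma negligible_differentiable_image_lowdim_subspace:
  fixes f :: "'a::euclidean_space \<Rightarrow> 'b::euclidean_space"
  assumes "subspace T" "dim T < DIM('b)" "S \<subseteq> T" "f differentiable_on S"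
  shows "negligible (f ` S)"
proof -
  obtain T' :: "'b set" where T': "subspace T'" "dim T' = dim T"
    using choose_subspace_of_subspace[of "dim T" "UNIV :: 'b set"] assms(2)
    by (auto simp: dim_UNIV)
  obtain g :: "'a \<Rightarrow> 'b" and h :: "'b \<Rightarrow> 'a" where gh: "linear g" "linear h" "g ` T = T'"
     "\<And>x. x \<in> T \<Longrightarrow> h (g x) = x"
    using isometries_subspaces[OF assms(1) T'(1) T'(2)[symmetric]] by metis
  have neg: "negligible (g ` S)"
    by (rule negligible_subset[OF negligible_lowdim[of T']]) (use T' gh assms in auto)
  have img: "h ` g ` S = S" using gh(4) assms(3) by (auto simp: image_image subset_iff)
  have "(f \<circ> h) differentiable_on (g ` S)"
    unfolding o_def
    by (rule differentiable_on_compose) (use gh(2) assms(4) img in \<open>simp_all add: linear_imp_differentiable_on\<close>)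
  then have "negligible ((f \<circ> h) ` (g ` S))"
    using negligible_differentiable_image_negligible[OF order_refl neg] by blast
  moreover have "(f \<circ> h) ` (g ` S) = f ` S"
    using img by (metis image_comp)
  ultimately show ?thesis by simp
qed

lemma cone_negligible_differentiable_image:
  fixes f :: "'a::euclidean_space \<Rightarrow> 'b::euclidean_space"
  assumes "subspace T" "dim T + 2 \<le> DIM('b)" "S \<subseteq> T" "f differentiable_on S"
  shows "cone_negligible (f ` S)"
  unfolding cone_negligible_def
proof
  fix a
  define F where "F = (\<lambda>z :: real \<times> 'a. a + fst z *\<^sub>R (f (snd z) - a))"
  have fs: "(\<lambda>z :: real \<times> 'a. f (snd z)) differentiable_on UNIV \<times> S"
    using differentiable_on_compose[of snd "UNIV \<times> S :: (real \<times> 'a) set" f] assms(4)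
    by (simp add: o_def bounded_linear_imp_differentiable_on bounded_linear_snd)
  have ff: "(\<lambda>z :: real \<times> 'a. fst z) differentiable_on UNIV \<times> S"
    by (simp add: bounded_linear_imp_differentiable_on bounded_linear_fst)
  have "F differentiable_on UNIV \<times> S"
    unfolding F_def using fs ff by (intro derivative_intros)
  moreover have "dim (UNIV \<times> T :: (real \<times> 'a) set) = 1 + dim T"
    using assms(1) by (simp add: dim_Times)
  ultimately have "negligible (F ` (UNIV \<times> S))"
    using assms by (intro negligible_differentiable_image_lowdim_subspace[of "UNIV \<times> T"])
      (auto intro: subspace_Times)
  moreover have "{a + s *\<^sub>R (b - a) | s b. b \<in> f ` S} = F ` (UNIV \<times> S)"
    unfolding F_def by force
  ultimately show "negligible {a + s *\<^sub>R (b - a) | s b. b \<in> f ` S}" by simp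
qed

section \<open>Matrices as a Euclidean model of \<open>Hom(V, W)\<close>\<close>

lemma dim_zero_coordinates:
  fixes Z :: "'a::euclidean_space set"
  assumes "Z \<subseteq> Basis"
  shows "dim {x. \<forall>z\<in>Z. x \<bullet> z = 0} = DIM('a) - card Z"
proof -
  have "{x. \<forall>z\<in>Z. x \<bullet> z = 0} = {x. \<forall>i\<in>Basis. i \<notin> Basis - Z \<longrightarrow> x \<bullet> i = 0}"
    using assms by auto
  then show ?thesis
    using dim_substandard[of "Basis - Z"] assms finite_subset[OF assms finite_Basis]
    by (simp add: card_Diff_subset)
qed

text \<open>
  The operator norm is not Euclidean, so Lebesgue measure on \<open>Hom(V, W)\<close> is taken from a type of
  matrices: a map is given by its columns, the values on the standard basis of \<open>V\<close>.  The columns are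
  indexed by a finite type with exactly \<open>dim V\<close> elements, as the dimension count is sharp.
\<close>

typedef (overloaded) 'v basis_index = "Basis :: 'v::euclidean_space set"
  morphisms basis_vec Basis_index
  using nonempty_Basis by blast

instance basis_index :: (euclidean_space) finite
proof
  have "finite (basis_vec -` Basis :: 'a basis_index set)"
    by (intro finite_vimageI) (auto simp: inj_on_def basis_vec_inject)
  moreover have "(basis_vec -` Basis :: 'a basis_index set) = UNIV"
    using basis_vec by auto
  ultimately show "finite (UNIV :: 'a basis_index set)" by simp
qed

lemma bij_betw_basis_vec: "bij_betw (basis_vec :: 'v::euclidean_space basis_index \<Rightarrow> 'v) UNIV Basis"
  using type_definition.Rep_range[OF type_definition_basis_index]
  by (simp add: bij_betw_def inj_on_def basis_vec_inject)

lemma CARD_basis_index: "CARD('v::euclidean_space basis_index) = DIM('v)"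
  using bij_betw_same_card[OF bij_betw_basis_vec] .

definition mat_app :: "'w::euclidean_space ^ 'v basis_index \<Rightarrow> 'v::euclidean_space \<Rightarrow> 'w" where
  "mat_app A v = (\<Sum>i\<in>UNIV. (v \<bullet> basis_vec i) *\<^sub>R (A $ i))"

lemma linear_mat_app: "linear (mat_app A)"
  by (rule linearI) (simp_all add: mat_app_def inner_add_left scaleR_add_left sum.distrib
      scaleR_sum_right)

lemma linear_mat_app_left: "linear (\<lambda>A. mat_app A v)"
  by (rule linearI) (simp_all add: mat_app_def scaleR_add_right sum.distrib scaleR_sum_right mult.commute)

lemma mat_app_basis_vec: "mat_app A (basis_vec i) = A $ i"
proof -
  have "basis_vec i \<bullet> basis_vec k = (if k = i then 1 else 0)" for k
    using inner_Basis[OF basis_vec basis_vec, of i k] by (auto simp: basis_vec_inject)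
  then have "mat_app A (basis_vec i) = (\<Sum>k\<in>UNIV. if k = i then A $ k else 0)"
    unfolding mat_app_def by (intro sum.cong) simp_all
  then show ?thesis by simp
qed

definition mat_hom :: "'w::euclidean_space ^ 'v basis_index \<Rightarrow> ('v::euclidean_space \<Rightarrow>\<^sub>L 'w)" where
  "mat_hom A = Blinfun (mat_app A)"

lemma blinfun_apply_mat_hom [simp]: "blinfun_apply (mat_hom A) = mat_app A"
  unfolding mat_hom_def
  by (rule bounded_linear_Blinfun_apply) (simp add: linear_mat_app linear_conv_bounded_linear[symmetric])

lemma linear_mat_hom: "linear mat_hom"
  by (rule linearI; rule blinfun_eqI)
    (simp_all add: linear_add[OF linear_mat_app_left] linear_scale[OF linear_mat_app_left]
      blinfun.add_left blinfun.scaleR_left)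

lemma surj_mat_hom: "surj mat_hom"
proof
  show "UNIV \<subseteq> range (mat_hom :: 'w::euclidean_space ^ 'v::euclidean_space basis_index \<Rightarrow> _)"
  proof
    fix f :: "'v \<Rightarrow>\<^sub>L 'w"
    have "mat_app (\<chi> i. f (basis_vec i)) v = f v" for v
    proof -
      have "f v = f (\<Sum>b\<in>Basis. (v \<bullet> b) *\<^sub>R b)" by (simp only: euclidean_representation)
      also have "\<dots> = (\<Sum>b\<in>Basis. (v \<bullet> b) *\<^sub>R f b)"
        by (simp add: blinfun.sum_right blinfun.scaleR_right)
      also have "\<dots> = mat_app (\<chi> i. f (basis_vec i)) v"
        using sum.reindex_bij_betw[OF bij_betw_basis_vec, of "\<lambda>b. (v \<bullet> b) *\<^sub>R f b"]
        by (simp add: mat_app_def)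
      finally show ?thesis by simp
    qed
    then have "f = mat_hom (\<chi> i. f (basis_vec i))" by (intro blinfun_eqI) simp
    then show "f \<in> range mat_hom" by blast
  qed
qed simp

lemma connected_complement_hom:
  fixes B :: "('v::euclidean_space \<Rightarrow>\<^sub>L 'w::euclidean_space) set"
  assumes "cone_negligible (mat_hom -` B)"
  shows "connected (UNIV - B)"
proof -
  have "connected (mat_hom ` (UNIV - mat_hom -` B))"
    using linear_mat_hom connected_complement_cone_negligible[OF assms]
    by (intro connected_continuous_image linear_continuous_on) (auto simp: linear_conv_bounded_linear[symmetric])
  moreover have "mat_hom ` (UNIV - mat_hom -` B) = UNIV - B"
    using surj_image_vimage_eq[OF surj_mat_hom, of "- B"] by (simp add: Compl_eq_Diff_UNIV vimage_Diff)
  ultimately show ?thesis by simp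
qed

section \<open>Two families of linear maps with negligible cones\<close>

lemma differentiable_on_bilinear:
  fixes p :: "'a::euclidean_space \<Rightarrow> 'b::euclidean_space \<Rightarrow> 'c::real_normed_vector"
  assumes "bilinear p" "f differentiable_on S" "g differentiable_on S"
  shows "(\<lambda>x. p (f x) (g x)) differentiable_on S"
proof -
  have "(\<lambda>z. p (fst z) (snd z)) differentiable_on ((\<lambda>x. (f x, g x)) ` S)"
    using bounded_bilinear.FDERIV[OF _ has_derivative_fst[OF has_derivative_ident] has_derivative_snd[OF has_derivative_ident], of p]
      assms(1) bilinear_conv_bounded_bilinear[of p]
    unfolding differentiable_on_def differentiable_def by blast
  moreover have "(\<lambda>x. (f x, g x)) differentiable_on S"
    using assms(2,3) unfolding differentiable_on_def differentiable_def
    by (blast intro: has_derivative_Pair)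
  ultimately show ?thesis
    using differentiable_on_compose[of "\<lambda>x. (f x, g x)" S "\<lambda>z. p (fst z) (snd z)"] by simp
qed

lemma differentiable_on_linear_compose:
  fixes h :: "'a::euclidean_space \<Rightarrow> 'b::real_normed_vector"
  assumes "linear h" "f differentiable_on S"
  shows "(\<lambda>x. h (f x)) differentiable_on S"
  using assms by (intro differentiable_on_compose[of f S h] linear_imp_differentiable_on)

lemma bilinear_mat_app: "bilinear mat_app"
  unfolding bilinear_def using linear_mat_app linear_mat_app_left by blast

lemma mat_app_axis: "mat_app (axis i w) v = (v \<bullet> basis_vec i) *\<^sub>R w"
proof -
  have "mat_app (axis i w) v = (\<Sum>k\<in>UNIV. if k = i then (v \<bullet> basis_vec k) *\<^sub>R w else 0)"
    unfolding mat_app_def by (intro sum.cong) (simp_all add: axis_def)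
  then show ?thesis by simp
qed

lemma linear_axis: "linear (axis i)"
  by (rule linearI) (simp_all add: axis_def vec_eq_iff)

lemma not_surj_iff_orthogonal:
  fixes f :: "'a::euclidean_space \<Rightarrow> 'b::euclidean_space"
  assumes "linear f"
  shows "\<not> surj f \<longleftrightarrow> (\<exists>w. norm w = 1 \<and> (\<forall>v. w \<bullet> f v = 0))"
    (is "?L \<longleftrightarrow> ?R")
proof
  assume ?L
  then have "range f \<noteq> UNIV" by simp
  moreover have "subspace (range f)" using assms by (simp add: linear_subspace_image)
  ultimately obtain w where w: "w \<noteq> 0" "\<And>y. y \<in> range f \<Longrightarrow> orthogonal w y"
    using orthogonal_to_subspace_exists[of "range f"]
    by (metis dim_eq_full span_eq_iff dim_subset_UNIV le_neq_implies_less)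
  show ?R
    by (rule exI[of _ "(1 / norm w) *\<^sub>R w"]) (use w in \<open>auto simp: orthogonal_def\<close>)
next
  assume ?R
  then obtain w where w: "norm w = 1" "\<And>v. w \<bullet> f v = 0" by auto
  show ?L
  proof
    assume "surj f"
    then obtain v where "w = f v" by (metis surjD)
    then have "w \<bullet> w = 0" using w(2)[of v] by simp
    then show False using w(1) by simp
  qed
qed

text \<open>
  A matrix that is not surjective satisfies \<open>w\<^sub>0 \<bullet> A = 0\<close> for some \<open>w\<^sub>0 \<noteq> 0\<close>.  If the \<open>c\<close>-coordinate of
  \<open>w\<^sub>0\<close> is normalised to 1, the \<open>c\<close>-row of \<open>A\<close> is determined by the other rows and by
  \<open>w = w\<^sub>0 - c\<close>.  Hence the matrices in question are covered by the images of the maps \<open>F c\<close>, whose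
  arguments \<open>(w, k)\<close> have vanishing \<open>c\<close>-coordinates.
\<close>

lemma cone_negligible_not_surj:
  assumes "DIM('w::euclidean_space) < DIM('v::euclidean_space)"
  shows "cone_negligible {A :: 'w ^ 'v basis_index. \<not> surj (mat_app A)}"
proof -
  define Z where "Z c = (\<lambda>i :: 'v basis_index. axis i c) ` UNIV" for c :: 'w
  define T where "T c = {w :: 'w. \<forall>z\<in>{c}. w \<bullet> z = 0} \<times>
      {k :: 'w ^ 'v basis_index. \<forall>z\<in>Z c. k \<bullet> z = 0}" for c
  define q where "q c w k = (\<chi> i. (w \<bullet> (k $ i)) *\<^sub>R c)" for c w :: 'w and k :: "'w ^ 'v basis_index"
  define F where "F c z = snd z - q c (fst z) (snd z)" for c z
  have "cone_negligible (F c ` T c)" if c: "c \<in> Basis" for c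
  proof (rule cone_negligible_differentiable_image)
    show "subspace (T c)"
      unfolding T_def by (intro subspace_Times) (auto simp: subspace_def inner_add_left)
    have Z: "Z c \<subseteq> Basis" using c by (auto simp: Z_def axis_in_Basis_iff)
    have "card (Z c) = DIM('v)"
      unfolding Z_def using c CARD_basis_index[where 'v = 'v]
      by (subst card_image) (auto simp: inj_on_def axis_eq_axis)
    then have "dim (T c) = (DIM('w) - 1) + (DIM('v) * DIM('w) - DIM('v))"
      unfolding T_def using dim_zero_coordinates[OF Z] dim_zero_coordinates[of "{c}"] c
      by (subst dim_Times) (auto simp: subspace_def inner_add_left CARD_basis_index)
    moreover obtain d where d: "DIM('w) = Suc d"
      by (metis DIM_positive Suc_pred)
    ultimately show "dim (T c) + 2 \<le> DIM('w ^ 'v basis_index)"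
      using assms by (simp add: CARD_basis_index)
    have q: "bilinear (q c)"
      unfolding bilinear_def
      by (auto intro!: linearI simp: q_def vec_eq_iff inner_add_left inner_add_right scaleR_add_left)
    show "F c differentiable_on T c"
      unfolding F_def
      by (rule differentiable_on_diff[OF _ differentiable_on_bilinear[OF q]])
        (auto intro: linear_imp_differentiable_on linear_fst linear_snd)
  qed simp
  then have "cone_negligible (\<Union>c\<in>Basis. F c ` T c)"
    by (intro cone_negligible_UN) (auto intro: countable_finite)
  moreover have "{A :: 'w ^ 'v basis_index. \<not> surj (mat_app A)} \<subseteq> (\<Union>c\<in>Basis. F c ` T c)"
  proof
    fix A :: "'w ^ 'v basis_index" assume "A \<in> {A. \<not> surj (mat_app A)}"
    then obtain w0 where w0: "norm w0 = 1" "\<And>v. w0 \<bullet> mat_app A v = 0"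
      using not_surj_iff_orthogonal[OF linear_mat_app] by blast
    then have "w0 \<noteq> 0" by auto
    then obtain c where c: "c \<in> Basis" "w0 \<bullet> c \<noteq> 0"
      using euclidean_all_zero_iff by blast
    define w where "w = (1 / (w0 \<bullet> c)) *\<^sub>R w0 - c"
    define k where "k = (\<chi> i. A $ i - (A $ i \<bullet> c) *\<^sub>R c)"
    have cc: "c \<bullet> c = 1" using c by simp
    have w0A: "w0 \<bullet> A $ i = 0" for i
      using w0(2)[of "basis_vec i"] by (simp add: mat_app_basis_vec)
    have "w \<bullet> c = 0" using c cc by (simp add: w_def inner_diff_left)
    moreover have "k $ i \<bullet> c = 0" for i using cc by (simp add: k_def inner_diff_left)
    ultimately have "(w, k) \<in> T c" by (auto simp: T_def Z_def inner_axis)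
    moreover have "w \<bullet> k $ i = - (A $ i \<bullet> c)" for i
    proof -
      have "(1 / (w0 \<bullet> c)) *\<^sub>R w0 \<bullet> k $ i = - (A $ i \<bullet> c)"
        using c w0A by (simp add: k_def inner_diff_right)
      moreover have "c \<bullet> k $ i = 0" using cc by (simp add: k_def inner_diff_right inner_commute)
      ultimately show ?thesis by (simp add: w_def inner_diff_left)
    qed
    then have "A = F c (w, k)" by (simp add: F_def q_def k_def vec_eq_iff)
    ultimately show "A \<in> (\<Union>c\<in>Basis. F c ` T c)" using c by blast
  qed
  ultimately show ?thesis by (rule cone_negligible_subset)
qed

text \<open>
  Maps that vanish on one of the planes spanned by \<open>v p\<close> and \<open>u p\<close>.  The normalisation says that the
  pair is in echelon form with pivots \<open>i\<close> and \<open>j\<close>; Gaussian elimination then recovers the columns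
  \<open>i\<close> and \<open>j\<close> of the matrix from the remaining ones, so that it depends on \<open>p\<close> and on a matrix \<open>k\<close> with
  two zero columns.  The bound on \<open>dim T\<close> is what two columns pay for, less 2 for the codimension.
\<close>

lemma cone_negligible_kill_two_vectors:
  fixes v u :: "'p::euclidean_space \<Rightarrow> 'v::euclidean_space"
  assumes T: "subspace T" "dim T + 2 \<le> 2 * DIM('w::euclidean_space)"
    and S: "S \<subseteq> T" "v differentiable_on S" "u differentiable_on S"
    and ij: "i \<in> Basis" "j \<in> Basis" "i \<noteq> j"
    and vu: "\<And>p. p \<in> S \<Longrightarrow> v p \<bullet> i = 1" "\<And>p. p \<in> S \<Longrightarrow> u p \<bullet> i = 0"
      "\<And>p. p \<in> S \<Longrightarrow> u p \<bullet> j \<noteq> 0"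
  shows "cone_negligible {A :: 'w ^ 'v basis_index. \<exists>p\<in>S. mat_app A (v p) = 0 \<and> mat_app A (u p) = 0}"
proof -
  define a where "a = Basis_index i"
  define b where "b = Basis_index j"
  have ab: "basis_vec a = i" "basis_vec b = j" "a \<noteq> b"
    using ij by (auto simp: a_def b_def Basis_index_inverse Basis_index_inject)
  define Z where "Z = (\<lambda>(x, c). axis x c :: 'w ^ 'v basis_index) ` ({a, b} \<times> Basis)"
  define K where "K = {k :: 'w ^ 'v basis_index. \<forall>z\<in>Z. k \<bullet> z = 0}"
  define u' where "u' p = (1 / (u p \<bullet> j)) *\<^sub>R u p" for p
  \<comment> \<open>The two subtracted terms restore the columns \<open>b\<close> and \<open>a\<close>, solved from \<open>A u' = 0\<close> first and
    then from \<open>A v = 0\<close>.\<close>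
  define F :: "'p \<times> ('w ^ 'v basis_index) \<Rightarrow> 'w ^ 'v basis_index"
    where "F z = snd z - axis b (mat_app (snd z) (u' (fst z)))
      - axis a (mat_app (snd z) (v (fst z)) - (v (fst z) \<bullet> j) *\<^sub>R mat_app (snd z) (u' (fst z)))" for z
  have "cone_negligible (F ` (S \<times> K))"
  proof (rule cone_negligible_differentiable_image)
    have sK: "subspace K" unfolding K_def by (auto simp: subspace_def inner_add_left)
    then show "subspace (T \<times> K)" using T(1) by (rule subspace_Times[rotated])
    have Z: "Z \<subseteq> Basis" by (auto simp: Z_def axis_in_Basis_iff)
    have "inj_on (\<lambda>(x, c). axis x c :: 'w ^ 'v basis_index) ({a, b} \<times> Basis)"
      by (auto simp: inj_on_def axis_eq_axis)
    then have "card Z = 2 * DIM('w)"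
      using ab(3) unfolding Z_def by (subst card_image) (auto simp: card_cartesian_product)
    moreover have "card Z \<le> DIM('w ^ 'v basis_index)" using Z by (intro card_mono finite_Basis)
    ultimately show "dim (T \<times> K) + 2 \<le> DIM('w ^ 'v basis_index)"
      using T(2) dim_zero_coordinates[OF Z] dim_Times[OF T(1) sK] unfolding K_def[symmetric] by linarith
    show "S \<times> K \<subseteq> T \<times> K" using S(1) by blast
    have f: "(\<lambda>z. g (fst z)) differentiable_on S \<times> K" if "g differentiable_on S"
      for g :: "'p \<Rightarrow> 'v"
      using that by (intro differentiable_on_compose[of fst "S \<times> K" g])
        (auto intro: linear_imp_differentiable_on linear_fst intro: differentiable_on_subset)
    have vj: "(\<lambda>z. v (fst z) \<bullet> j) differentiable_on S \<times> K"
      using f[OF S(2)] by (intro differentiable_on_linear_compose[of "\<lambda>x. x \<bullet> j"])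
        (auto intro!: linearI simp: inner_add_left)
    have "(\<lambda>p. u p \<bullet> j) differentiable_on S"
      using S(3) by (intro differentiable_on_linear_compose[of "\<lambda>x. x \<bullet> j"])
        (auto intro!: linearI simp: inner_add_left)
    then have "(\<lambda>p. 1 / (u p \<bullet> j)) differentiable_on S"
      using vu(3) by (auto simp: differentiable_on_def intro!: differentiable_divide)
    then have "u' differentiable_on S"
      unfolding u'_def using S(3) by (intro differentiable_on_scaleR)
    then have mu: "(\<lambda>z. mat_app (snd z) (u' (fst z))) differentiable_on S \<times> K"
      using f[OF \<open>u' differentiable_on S\<close>]
      by (intro differentiable_on_bilinear[OF bilinear_mat_app])
        (auto intro: linear_imp_differentiable_on linear_snd)
    have mv: "(\<lambda>z. mat_app (snd z) (v (fst z))) differentiable_on S \<times> K"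
      using f[OF S(2)]
      by (intro differentiable_on_bilinear[OF bilinear_mat_app])
        (auto intro: linear_imp_differentiable_on linear_snd)
    show "F differentiable_on S \<times> K"
      unfolding F_def
      by (intro differentiable_on_diff differentiable_on_linear_compose[OF linear_axis]
          differentiable_on_scaleR mu mv vj)
        (auto intro: linear_imp_differentiable_on linear_snd)
  qed
  moreover have "{A :: 'w ^ 'v basis_index. \<exists>p\<in>S. mat_app A (v p) = 0 \<and> mat_app A (u p) = 0} \<subseteq> F ` (S \<times> K)"
  proof clarify
    fix A :: "'w ^ 'v basis_index" and p
    assume p: "p \<in> S" and Av: "mat_app A (v p) = 0" and Au: "mat_app A (u p) = 0"
    define k where "k = A - axis a (A $ a) - axis b (A $ b)"
    have kx: "mat_app k x = mat_app A x - (x \<bullet> i) *\<^sub>R A $ a - (x \<bullet> j) *\<^sub>R A $ b" for x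
      using ab by (simp add: k_def linear_diff[OF linear_mat_app_left] mat_app_axis)
    have "mat_app k (u p) = - ((u p \<bullet> j) *\<^sub>R A $ b)" using kx[of "u p"] Au vu(2)[OF p] by simp
    then have ku: "mat_app k (u' p) = - (A $ b)"
      using vu(3)[OF p] by (simp add: u'_def linear_scale[OF linear_mat_app])
    have kv: "mat_app k (v p) = - (A $ a) - (v p \<bullet> j) *\<^sub>R A $ b"
      using kx[of "v p"] Av vu(1)[OF p] by simp
    have "A = F (p, k)"
      unfolding F_def fst_conv snd_conv ku kv by (simp add: k_def linear_neg[OF linear_axis])
    moreover have "k $ a = 0" "k $ b = 0"
      using ab(3) by (simp_all add: k_def axis_def)
    then have "k \<in> K" by (auto simp: K_def Z_def inner_axis)
    ultimately show "A \<in> F ` (S \<times> K)" using p by blast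
  qed
  ultimately show ?thesis by (rule cone_negligible_subset)
qed

section \<open>Smooth functions and their restriction to lines\<close>

lemma Ck_on_cong:
  assumes "open S" "Ck_on k S f" "\<And>x. x \<in> S \<Longrightarrow> f x = g x"
  shows "Ck_on k S g"
  using assms(2,3)
proof (induction k arbitrary: f g)
  case 0
  then show ?case by (simp cong: continuous_on_cong)
next
  case (Suc k)
  have der: "(g has_derivative frechet_derivative f (at x)) (at x)" if "x \<in> S" for x
    using Suc.prems that assms(1) frechet_derivative_works[of f "at x"]
    by (auto intro: has_derivative_transform_within_open)
  then have "frechet_derivative f (at x) v = frechet_derivative g (at x) v" if "x \<in> S" for x v
    using that frechet_derivative_at by fastforce
  then have "Ck_on k S (\<lambda>x. frechet_derivative g (at x) v)" for v
    using Suc.IH[of "\<lambda>x. frechet_derivative f (at x) v"] Suc.prems(1) by auto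
  then show ?case using der by (auto simp: differentiable_def)
qed

text \<open>
  The derivative of \<open>t \<mapsto> f (x + t e)\<close> in direction \<open>v\<close> is again the restriction to the line of a partial
  derivative of \<open>f\<close>, namely the one in direction \<open>v e\<close>.  Restricting to lines instead of composing
  with general smooth maps avoids the higher chain rule.
\<close>

lemma Ck_on_along_line:
  fixes x e :: "'a::euclidean_space"
  assumes "open I" "\<And>t. t \<in> I \<Longrightarrow> x + t *\<^sub>R e \<in> U" "Ck_on k U f"
  shows "Ck_on k I (\<lambda>t. f (x + t *\<^sub>R e))"
  using assms(3)
proof (induction k arbitrary: f)
  case 0
  have "continuous_on I (\<lambda>t. x + t *\<^sub>R e)" by (intro continuous_intros)
  then show ?case using 0 assms(2) by (auto intro: continuous_on_compose2)
next
  case (Suc k)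
  have der: "((\<lambda>t. f (x + t *\<^sub>R e)) has_derivative
      (\<lambda>s. frechet_derivative f (at (x + t *\<^sub>R e)) (s *\<^sub>R e))) (at t)" if "t \<in> I" for t
  proof -
    have "(f has_derivative frechet_derivative f (at (x + t *\<^sub>R e))) (at (x + t *\<^sub>R e))"
      using Suc.prems assms(2)[OF that] frechet_derivative_works by auto
    moreover have "((\<lambda>t. x + t *\<^sub>R e) has_derivative (\<lambda>s. s *\<^sub>R e)) (at t)"
      by (auto intro!: derivative_eq_intros)
    ultimately show ?thesis
      using diff_chain_at[of "\<lambda>t. x + t *\<^sub>R e" "\<lambda>s. s *\<^sub>R e" t f] by (simp add: o_def)
  qed
  have "Ck_on k I (\<lambda>t. frechet_derivative (\<lambda>t. f (x + t *\<^sub>R e)) (at t) v)" for v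
  proof (rule Ck_on_cong[OF assms(1)])
    show "Ck_on k I (\<lambda>t. frechet_derivative f (at (x + t *\<^sub>R e)) (v *\<^sub>R e))"
      using Suc.prems by (intro Suc.IH[of "\<lambda>y. frechet_derivative f (at y) (v *\<^sub>R e)"]) auto
    show "frechet_derivative f (at (x + t *\<^sub>R e)) (v *\<^sub>R e) =
        frechet_derivative (\<lambda>t. f (x + t *\<^sub>R e)) (at t) v" if "t \<in> I" for t
      using frechet_derivative_at[OF der[OF that]] by (metis)
  qed
  then show ?case using der by (auto simp: differentiable_def)
qed

lemma smooth_on_has_derivative:
  assumes "smooth_on S f" "x \<in> S"
  shows "(f has_derivative frechet_derivative f (at x)) (at x)"
proof -
  have "Ck_on (Suc 0) S f" using assms(1) unfolding smooth_on_def by blast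
  then show ?thesis using assms(2) frechet_derivative_works by auto
qed

lemma smooth_on_frechet_derivative:
  assumes "smooth_on S f"
  shows "smooth_on S (\<lambda>x. frechet_derivative f (at x) v)"
  unfolding smooth_on_def
proof
  fix k
  have "Ck_on (Suc k) S f" using assms unfolding smooth_on_def by blast
  then show "Ck_on k S (\<lambda>x. frechet_derivative f (at x) v)" by simp
qed

lemma vector_derivative_in_subspace:
  fixes \<kappa> :: "real \<Rightarrow> 'a::euclidean_space"
  assumes "subspace E" "(\<kappa> has_vector_derivative e) (at t)" "\<forall>\<^sub>F s in nhds t. \<kappa> s \<in> E"
  shows "e \<in> E"
proof -
  obtain y z where yz: "y \<in> E" "\<And>w. w \<in> E \<Longrightarrow> orthogonal z w" "e = y + z"
    using orthogonal_subspace_decomp_exists[of E e] assms(1) by (metis span_eq_iff)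
  have "((\<lambda>s. z \<bullet> \<kappa> s) has_vector_derivative z \<bullet> e) (at t)"
    using assms(2) by (intro bounded_linear.has_vector_derivative[OF bounded_linear_inner_right])
  moreover have "\<forall>\<^sub>F s in nhds t. z \<bullet> \<kappa> s = 0"
    using assms(3) by eventually_elim (use yz(2) in \<open>simp add: orthogonal_def\<close>)
  then obtain V where "open V" "t \<in> V" "\<And>s. s \<in> V \<Longrightarrow> z \<bullet> \<kappa> s = 0"
    unfolding eventually_nhds by blast
  ultimately have "((\<lambda>s. 0) has_vector_derivative z \<bullet> e) (at t)"
    by (auto intro: has_vector_derivative_transform_within_open)
  then have "z \<bullet> e = 0"
    using vector_derivative_unique_at[OF _ has_vector_derivative_const] by blast
  then have "z = 0" using yz by (simp add: inner_add_right orthogonal_def)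
  then show ?thesis using yz by simp
qed

section \<open>Homomorphisms into quotients\<close>

lemma coset_eqD:
  assumes "subspace l" "(+) a ` l = (+) b ` l"
  shows "a - b \<in> l"
proof -
  have "a + 0 \<in> (+) a ` l" using subspace_0[OF assms(1)] by (rule imageI)
  then show ?thesis using assms(2) by auto
qed

lemma coset_eqI:
  assumes "subspace l" "a - b \<in> l"
  shows "(+) a ` l = (+) b ` l"
proof -
  have "(+) a ` l \<subseteq> (+) b ` l" if ab: "a - b \<in> l" for a b
  proof
    fix y assume "y \<in> (+) a ` l"
    then obtain z where z: "z \<in> l" "y = a + z" by blast
    then have "(a - b) + z \<in> l" using ab assms(1) by (intro subspace_add)
    moreover have "y = b + ((a - b) + z)" using z by simp
    ultimately show "y \<in> (+) b ` l" by blast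
  qed
  moreover have "b - a \<in> l" using subspace_neg[OF assms] by simp
  ultimately show ?thesis using assms(2) by blast
qed

lemma quot_hom_iff:
  "h \<in> quot_hom l Y \<longleftrightarrow> h \<in> l \<rightarrow>\<^sub>E (\<lambda>w. (+) w ` l) ` Y \<and>
    (\<forall>x\<in>l. \<forall>y\<in>l. \<forall>a b. \<forall>u\<in>h x. \<forall>w\<in>h y. a *\<^sub>R u + b *\<^sub>R w \<in> h (a *\<^sub>R x + b *\<^sub>R y))"
  by (simp only: quot_hom_def mem_Collect_eq)

lemma quot_hom_value:
  assumes "h \<in> quot_hom l Y" "x \<in> l"
  obtains w where "w \<in> Y" "h x = (+) w ` l"
proof -
  have "h \<in> l \<rightarrow>\<^sub>E (\<lambda>w. (+) w ` l) ` Y" using assms(1) unfolding quot_hom_iff by (rule conjunct1)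
  then have "h x \<in> (\<lambda>w. (+) w ` l) ` Y" using assms(2) by (rule PiE_mem)
  then show thesis using that by blast
qed

lemma quot_hom_linear:
  assumes "h \<in> quot_hom l Y" "x \<in> l" "y \<in> l" "u \<in> h x" "w \<in> h y"
  shows "a *\<^sub>R u + b *\<^sub>R w \<in> h (a *\<^sub>R x + b *\<^sub>R y)"
proof -
  have "\<forall>x\<in>l. \<forall>y\<in>l. \<forall>a b. \<forall>u\<in>h x. \<forall>w\<in>h y. a *\<^sub>R u + b *\<^sub>R w \<in> h (a *\<^sub>R x + b *\<^sub>R y)"
    using assms(1) unfolding quot_hom_iff by (rule conjunct2)
  then show ?thesis using assms(2-5) by meson
qed

lemma quot_hom_restrict_codomain:
  assumes "h \<in> quot_hom l Y" "\<And>x. x \<in> l \<Longrightarrow> h x \<in> (\<lambda>w. (+) w ` l) ` Z"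
  shows "h \<in> quot_hom l Z"
proof -
  have "h \<in> l \<rightarrow>\<^sub>E (\<lambda>w. (+) w ` l) ` Y" using assms(1) unfolding quot_hom_iff by (rule conjunct1)
  then have "h \<in> l \<rightarrow>\<^sub>E (\<lambda>w. (+) w ` l) ` Z"
    using assms(2) by (intro PiE_I) (auto elim: PiE_arb)
  moreover have "\<forall>x\<in>l. \<forall>y\<in>l. \<forall>a b. \<forall>u\<in>h x. \<forall>w\<in>h y. a *\<^sub>R u + b *\<^sub>R w \<in> h (a *\<^sub>R x + b *\<^sub>R y)"
    using assms(1) unfolding quot_hom_iff by (rule conjunct2)
  ultimately show ?thesis unfolding quot_hom_iff by (rule conjI)
qed

lemma quot_hom_mono:
  assumes "Y \<subseteq> Y'"
  shows "quot_hom l Y \<subseteq> quot_hom l Y'"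
proof
  fix h assume h: "h \<in> quot_hom l Y"
  then show "h \<in> quot_hom l Y'"
  proof (rule quot_hom_restrict_codomain)
    fix x assume "x \<in> l"
    with h obtain w where "w \<in> Y" "h x = (+) w ` l" by (rule quot_hom_value)
    then show "h x \<in> (\<lambda>w. (+) w ` l) ` Y'" using assms by (intro image_eqI[of _ _ w]) auto
  qed
qed

text \<open>
  A subspace \<open>Y\<close> that contains \<open>l\<close> can be recovered from \<open>Hom(l, Y/l)\<close>, because a homomorphism can send
  the generator \<open>v\<close> of \<open>l\<close> to any class: \<open>x \<mapsto> (x \<bullet> i) y + l\<close> sends it to the class of \<open>y\<close>.  This makes
  the fibre \<open>Y\<^sub>l\<close> unique.
\<close>

lemma quot_hom_subset_imp_subset:
  fixes v i :: "'v::real_inner"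
  assumes vi: "v \<bullet> i = 1" and l: "l = span {v}" and Y: "subspace Y" and Y': "subspace Y'" "l \<subseteq> Y'"
    and sub: "quot_hom l Y \<subseteq> quot_hom l Y'"
  shows "Y \<subseteq> Y'"
proof
  fix y assume y: "y \<in> Y"
  have sl: "subspace l" by (simp add: l)
  define h where "h = (\<lambda>x\<in>l. (+) ((x \<bullet> i) *\<^sub>R y) ` l)"
  have hx: "h x = (+) ((x \<bullet> i) *\<^sub>R y) ` l" if "x \<in> l" for x using that by (simp add: h_def)
  have "h \<in> quot_hom l Y"
    unfolding quot_hom_def
  proof (intro CollectI conjI ballI allI)
    show "h \<in> l \<rightarrow>\<^sub>E (\<lambda>w. (+) w ` l) ` Y"
      using y Y by (auto simp: h_def subspace_scale)
    fix x z a b u w assume x: "x \<in> l" "z \<in> l" and uw: "u \<in> h x" "w \<in> h z"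
    from uw x obtain p q where pq: "p \<in> l" "q \<in> l" "u = (x \<bullet> i) *\<^sub>R y + p" "w = (z \<bullet> i) *\<^sub>R y + q"
      by (auto simp: hx)
    have "a *\<^sub>R u + b *\<^sub>R w = ((a *\<^sub>R x + b *\<^sub>R z) \<bullet> i) *\<^sub>R y + (a *\<^sub>R p + b *\<^sub>R q)"
      by (simp add: pq algebra_simps)
    moreover have "a *\<^sub>R p + b *\<^sub>R q \<in> l" "a *\<^sub>R x + b *\<^sub>R z \<in> l"
      using pq x sl by (auto intro: subspace_add subspace_scale)
    ultimately show "a *\<^sub>R u + b *\<^sub>R w \<in> h (a *\<^sub>R x + b *\<^sub>R z)" by (auto simp: hx)
  qed
  then have "h \<in> quot_hom l Y'" using sub by blast
  moreover have vl: "v \<in> l" by (simp add: l span_base)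
  ultimately obtain w where w: "w \<in> Y'" "h v = (+) w ` l"
    by (rule quot_hom_value)
  then have "y - w \<in> l" using hx[OF vl] vi sl by (intro coset_eqD) auto
  then have "(y - w) + w \<in> Y'" using w(1) Y' by (intro subspace_add) auto
  then show "y \<in> Y'" by simp
qed

section \<open>Slice charts and the bundle of tangent spaces\<close>

lemma span_singleton_scaleR: "c \<noteq> 0 \<Longrightarrow> span {c *\<^sub>R v} = span {v}" for v :: "'a::real_vector"
proof -
  assume "c \<noteq> 0"
  then have "v \<in> span {c *\<^sub>R v}"
    using span_scale[OF span_base[of "c *\<^sub>R v" "{c *\<^sub>R v}"], of "1 / c"] by simp
  then show ?thesis
    by (simp add: span_eq span_base span_scale)
qed

text \<open>
  A slice chart of the vectors with \<open>i\<close>-th coordinate 1 that span a line of \<open>X\<close>.  A line outside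
  the hyperplane where this coordinate vanishes contains exactly one vector with coordinate 1, so
  \<open>x \<mapsto> span {\<psi> x}\<close> parametrises an open part of \<open>X\<close> by an open subset of the \<open>m\<close>-dimensional
  space \<open>E\<close>.
\<close>

locale lift_chart =
  fixes X :: "'v::euclidean_space set set" and m :: nat and i :: 'v
    and U U' E :: "'v set" and \<phi> \<psi> :: "'v \<Rightarrow> 'v"
  assumes i: "i \<in> Basis"
    and open_U: "open U" and open_U': "open U'"
    and homeo: "homeomorphism U U' \<phi> \<psi>"
    and smooth_\<phi>: "smooth_on U \<phi>" and smooth_\<psi>: "smooth_on U' \<psi>"
    and E: "subspace E" "dim E = m"
    and slice: "\<phi> ` (U \<inter> {v. v \<bullet> i = 1 \<and> span {v} \<in> X}) = U' \<inter> E"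
begin

abbreviation D\<psi> :: "'v \<Rightarrow> 'v \<Rightarrow> 'v" where "D\<psi> x \<equiv> frechet_derivative \<psi> (at x)"

lemma \<psi>_point:
  assumes "x \<in> U'" "x \<in> E"
  shows "\<psi> x \<in> U" "\<psi> x \<bullet> i = 1" "span {\<psi> x} \<in> X" "\<phi> (\<psi> x) = x" "\<psi> x \<noteq> 0"
proof -
  have "x \<in> \<phi> ` (U \<inter> {v. v \<bullet> i = 1 \<and> span {v} \<in> X})" using assms slice by blast
  then obtain p where p: "p \<in> U" "p \<bullet> i = 1" "span {p} \<in> X" "x = \<phi> p" by blast
  moreover have "\<psi> (\<phi> p) = p" using homeo p(1) by (simp add: homeomorphism_apply1)
  ultimately show "\<psi> x \<in> U" "\<psi> x \<bullet> i = 1" "span {\<psi> x} \<in> X" "\<phi> (\<psi> x) = x" "\<psi> x \<noteq> 0"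
    by auto
qed

lemma \<phi>_point:
  assumes "p \<in> U" "p \<bullet> i = 1" "span {p} \<in> X"
  shows "\<phi> p \<in> U'" "\<phi> p \<in> E" "\<psi> (\<phi> p) = p"
  using assms slice homeo by (auto simp: homeomorphism_apply1)

lemma D\<psi>: "x \<in> U' \<Longrightarrow> (\<psi> has_derivative D\<psi> x) (at x)"
  using smooth_on_has_derivative[OF smooth_\<psi>] .

lemma linear_D\<psi>: "x \<in> U' \<Longrightarrow> linear (D\<psi> x)"
  using D\<psi> has_derivative_linear by blast

lemma line_in_slice:
  assumes "x \<in> U'" "x \<in> E" "e \<in> E"
  obtains \<epsilon> where "\<epsilon> > 0" "\<And>t. t \<in> {-\<epsilon><..<\<epsilon>} \<Longrightarrow> x + t *\<^sub>R e \<in> U'" "\<And>t. x + t *\<^sub>R e \<in> E"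
proof -
  have "open ((\<lambda>t. x + t *\<^sub>R e) -` U')"
    by (intro open_vimage open_U' continuous_intros)
  then obtain \<epsilon> where "\<epsilon> > 0" "ball 0 \<epsilon> \<subseteq> (\<lambda>t. x + t *\<^sub>R e) -` U'"
    using assms(1) openE[of "(\<lambda>t. x + t *\<^sub>R e) -` U'" 0] by auto
  then show thesis
    using assms E(1) by (intro that[of \<epsilon>]) (auto simp: subset_iff subspace_add subspace_scale)
qed

lemma line_has_vector_derivative:
  assumes "x \<in> U'"
  shows "((\<lambda>t. \<psi> (x + t *\<^sub>R e)) has_vector_derivative D\<psi> x e) (at 0)"
proof -
  have "((\<lambda>t. x + t *\<^sub>R e) has_vector_derivative e) (at 0)"
    by (auto intro!: derivative_eq_intros)
  then show ?thesis
    using vector_derivative_diff_chain_within[of "\<lambda>t. x + t *\<^sub>R e" e 0 UNIV \<psi> "D\<psi> x"] D\<psi>[OF assms]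
    by (simp add: o_def has_derivative_at_withinI)
qed

text \<open>
  The curve \<open>\<psi> (x + t e)\<close> stays in the affine hyperplane where the \<open>i\<close>-th coordinate is 1.  Consequently
  a vector \<open>D\<psi> x e\<close> lies on the line of \<open>\<psi> x\<close> only if it is zero.
\<close>

lemma D\<psi>_inner_i:
  assumes "x \<in> U'" "x \<in> E" "e \<in> E"
  shows "D\<psi> x e \<bullet> i = 0"
proof -
  obtain \<epsilon> where \<epsilon>: "\<epsilon> > 0" "\<And>t. t \<in> {-\<epsilon><..<\<epsilon>} \<Longrightarrow> x + t *\<^sub>R e \<in> U'" "\<And>t. x + t *\<^sub>R e \<in> E"
    using line_in_slice[OF assms] by blast
  have "((\<lambda>t. \<psi> (x + t *\<^sub>R e) \<bullet> i) has_vector_derivative D\<psi> x e \<bullet> i) (at 0)"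
    using line_has_vector_derivative[OF assms(1)]
    by (intro bounded_linear.has_vector_derivative[OF bounded_linear_inner_left])
  then have "((\<lambda>t. 1) has_vector_derivative D\<psi> x e \<bullet> i) (at (0::real))"
    by (rule has_vector_derivative_transform_within_open[of _ _ _ "{-\<epsilon><..<\<epsilon>}"])
      (use \<epsilon> \<psi>_point(2) in auto)
  then show ?thesis
    using vector_derivative_unique_at[OF _ has_vector_derivative_const] by blast
qed

lemma D\<phi>_D\<psi>:
  assumes "x \<in> U'"
  shows "frechet_derivative \<phi> (at (\<psi> x)) (D\<psi> x e) = e"
proof -
  have "\<psi> x \<in> U" using homeo assms by (auto simp: homeomorphism_def)
  then have "(\<phi> \<circ> \<psi> has_derivative frechet_derivative \<phi> (at (\<psi> x)) \<circ> D\<psi> x) (at x)"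
    by (intro diff_chain_at D\<psi> assms smooth_on_has_derivative[OF smooth_\<phi>])
  then have "(id has_derivative frechet_derivative \<phi> (at (\<psi> x)) \<circ> D\<psi> x) (at x)"
    by (rule has_derivative_transform_within_open[OF _ open_U' assms])
      (use homeo in \<open>auto simp: homeomorphism_apply2\<close>)
  then have "frechet_derivative \<phi> (at (\<psi> x)) \<circ> D\<psi> x = id"
    using has_derivative_unique[OF _ has_derivative_id] by blast
  then show ?thesis by (metis comp_apply id_apply)
qed

lemma D\<psi>_eq_0: "x \<in> U' \<Longrightarrow> D\<psi> x e = 0 \<longleftrightarrow> e = 0"
  using D\<phi>_D\<psi>[of x e] D\<phi>_D\<psi>[of x 0] linear_0[OF linear_D\<psi>] by metis

text \<open>
  The explicit description of the fibre \<open>Y\<^sub>l\<close> at \<open>l = span {\<psi> x}\<close>.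
\<close>

definition Y :: "'v \<Rightarrow> 'v set" where
  "Y x = {c *\<^sub>R \<psi> x + D\<psi> x e | c e. e \<in> E}"

lemma Y_I: "e \<in> E \<Longrightarrow> c *\<^sub>R \<psi> x + D\<psi> x e \<in> Y x"
  unfolding Y_def by blast

lemma subspace_Y:
  assumes "x \<in> U'"
  shows "subspace (Y x)"
proof -
  note lin = linear_0[OF linear_D\<psi>[OF assms]] linear_add[OF linear_D\<psi>[OF assms]]
    linear_scale[OF linear_D\<psi>[OF assms]]
  show ?thesis
    unfolding subspace_def
  proof (intro conjI ballI allI)
    show "0 \<in> Y x" using Y_I[of 0 0 x] E(1) lin by (simp add: subspace_0)
    fix a assume "a \<in> Y x"
    then obtain c e where a: "e \<in> E" "a = c *\<^sub>R \<psi> x + D\<psi> x e" unfolding Y_def by blast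
    show "r *\<^sub>R a \<in> Y x" for r
      using Y_I[of "r *\<^sub>R e" "r * c" x] a E(1) by (simp add: lin subspace_scale scaleR_add_right)
    fix b assume "b \<in> Y x"
    then obtain c' e' where b: "e' \<in> E" "b = c' *\<^sub>R \<psi> x + D\<psi> x e'" unfolding Y_def by blast
    show "a + b \<in> Y x"
      using Y_I[of "e + e'" "c + c'" x] a b E(1) by (simp add: lin subspace_add algebra_simps)
  qed
qed

lemma line_subset_Y:
  assumes "x \<in> U'"
  shows "span {\<psi> x} \<subseteq> Y x"
proof -
  have "\<psi> x \<in> Y x"
    using Y_I[of 0 1 x] E(1) linear_0[OF linear_D\<psi>[OF assms]] by (simp add: subspace_0)
  then show ?thesis using subspace_Y[OF assms] by (simp add: span_minimal)
qed

text \<open>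
  Rescaling a lift \<open>\<gamma>\<close> of a curve in \<open>X\<close> to the curve \<open>\<eta>\<close> with \<open>i\<close>-th coordinate 1 brings it into the
  range of \<open>\<psi>\<close>, where \<open>\<phi> \<circ> \<eta>\<close> is a curve in \<open>E\<close>.  So \<open>\<eta>\<close> has its velocity in the image of \<open>D\<psi> x\<close>, and
  the product rule for \<open>\<gamma> = (\<gamma> \<bullet> i) \<eta>\<close> only adds a multiple of \<open>\<psi> x\<close>.
\<close>

lemma lift_velocity_in_Y:
  assumes x: "x \<in> U'" "x \<in> E"
    and \<gamma>: "(\<gamma> has_vector_derivative g) (at 0)" "span {\<gamma> 0} = span {\<psi> x}"
    and X: "\<forall>\<^sub>F t in nhds 0. span {\<gamma> t} \<in> X"
  shows "g \<in> Y x"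
proof -
  have "\<gamma> 0 \<in> span {\<psi> x}" using \<gamma>(2) by (metis insertI1 span_base)
  then obtain c where c: "\<gamma> 0 = c *\<^sub>R \<psi> x" by (auto simp: span_singleton)
  have c0: "c \<noteq> 0"
  proof
    assume "c = 0"
    then have "span {\<psi> x} = {0}" using c \<gamma>(2) by simp
    then show False using \<psi>_point(5)[OF x] span_base[of "\<psi> x" "{\<psi> x}"] by auto
  qed
  have \<gamma>i: "((\<lambda>t. \<gamma> t \<bullet> i) has_vector_derivative g \<bullet> i) (at 0)"
    using \<gamma>(1) by (rule bounded_linear.has_vector_derivative[OF bounded_linear_inner_left])
  have \<gamma>0i: "\<gamma> 0 \<bullet> i = c" using c \<psi>_point(2)[OF x] by simp
  define \<eta> where "\<eta> t = (1 / (\<gamma> t \<bullet> i)) *\<^sub>R \<gamma> t" for t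
  have \<eta>0: "\<eta> 0 = \<psi> x" using c c0 \<gamma>0i by (simp add: \<eta>_def)
  have "(\<lambda>t. 1 / (\<gamma> t \<bullet> i)) differentiable (at 0)"
    using \<gamma>i \<gamma>0i c0 by (intro differentiable_divide) (auto simp: has_vector_derivative_def differentiable_def)
  then have "\<eta> differentiable (at 0)"
    unfolding \<eta>_def using \<gamma>(1)
    by (intro differentiable_scaleR) (auto simp: has_vector_derivative_def differentiable_def)
  then obtain \<eta>' where \<eta>': "(\<eta> has_vector_derivative \<eta>') (at 0)"
    using vector_derivative_works by blast
  have nz: "\<forall>\<^sub>F t in nhds 0. \<gamma> t \<bullet> i \<noteq> 0"
    using tendsto_imp_eventually_ne[OF has_vector_derivative_continuous[OF \<gamma>i, unfolded continuous_at], of 0]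
      \<gamma>0i c0 by (simp add: eventually_nhds_conv_at)
  have \<eta>U: "\<forall>\<^sub>F t in nhds 0. \<eta> t \<in> U"
    using topological_tendstoD[OF has_vector_derivative_continuous[OF \<eta>', unfolded continuous_at] open_U]
      \<eta>0 \<psi>_point(1)[OF x] by (simp add: eventually_nhds_conv_at)
  have good: "\<forall>\<^sub>F t in nhds 0. \<phi> (\<eta> t) \<in> E \<and> \<psi> (\<phi> (\<eta> t)) = \<eta> t \<and> \<gamma> t = (\<gamma> t \<bullet> i) *\<^sub>R \<eta> t"
    using nz \<eta>U X
  proof eventually_elim
    case (elim t)
    have "\<eta> t \<bullet> i = 1" using elim(1) by (simp add: \<eta>_def)
    moreover have "span {\<eta> t} \<in> X" using elim by (simp add: \<eta>_def span_singleton_scaleR)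
    ultimately show ?case using \<phi>_point elim by (simp add: \<eta>_def)
  qed
  then obtain V where V: "open V" "0 \<in> V" and
    V': "\<And>t. t \<in> V \<Longrightarrow> \<phi> (\<eta> t) \<in> E \<and> \<psi> (\<phi> (\<eta> t)) = \<eta> t \<and> \<gamma> t = (\<gamma> t \<bullet> i) *\<^sub>R \<eta> t"
    unfolding eventually_nhds by blast
  define e where "e = frechet_derivative \<phi> (at (\<psi> x)) \<eta>'"
  have \<kappa>: "((\<lambda>t. \<phi> (\<eta> t)) has_vector_derivative e) (at 0)"
    unfolding e_def
    using vector_derivative_diff_chain_within[of \<eta> \<eta>' 0 UNIV \<phi>] \<eta>' \<eta>0
      smooth_on_has_derivative[OF smooth_\<phi> \<psi>_point(1)[OF x]]
    by (simp add: o_def has_derivative_at_withinI)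
  have "\<forall>\<^sub>F t in nhds 0. \<phi> (\<eta> t) \<in> E" using good by eventually_elim blast
  then have eE: "e \<in> E" by (rule vector_derivative_in_subspace[OF E(1) \<kappa>])
  have "((\<lambda>t. \<psi> (\<phi> (\<eta> t))) has_vector_derivative D\<psi> x e) (at 0)"
    using vector_derivative_diff_chain_within[of "\<lambda>t. \<phi> (\<eta> t)" e 0 UNIV \<psi> "D\<psi> x"] \<kappa> \<eta>0
      \<psi>_point(4)[OF x] D\<psi>[OF x(1)]
    by (simp add: o_def has_derivative_at_withinI)
  then have "(\<eta> has_vector_derivative D\<psi> x e) (at 0)"
    by (rule has_vector_derivative_transform_within_open[OF _ V]) (use V' in blast)
  then have "\<eta>' = D\<psi> x e" using \<eta>' vector_derivative_unique_at by blast
  moreover have "((\<lambda>t. (\<gamma> t \<bullet> i) *\<^sub>R \<eta> t) has_vector_derivative c *\<^sub>R \<eta>' + (g \<bullet> i) *\<^sub>R \<psi> x) (at 0)"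
    using has_vector_derivative_scaleR[OF _ \<eta>', of "\<lambda>t. \<gamma> t \<bullet> i" "g \<bullet> i"] \<gamma>i \<gamma>0i \<eta>0
    by (simp add: has_real_derivative_iff_has_vector_derivative)
  then have "(\<gamma> has_vector_derivative c *\<^sub>R \<eta>' + (g \<bullet> i) *\<^sub>R \<psi> x) (at 0)"
    by (rule has_vector_derivative_transform_within_open[OF _ V]) (use V' in metis)
  then have "g = c *\<^sub>R \<eta>' + (g \<bullet> i) *\<^sub>R \<psi> x" using \<gamma>(1) vector_derivative_unique_at by blast
  ultimately have "g = (g \<bullet> i) *\<^sub>R \<psi> x + D\<psi> x (c *\<^sub>R e)"
    using linear_scale[OF linear_D\<psi>[OF x(1)]] by (simp add: add.commute)
  then show ?thesis using Y_I[of "c *\<^sub>R e" "g \<bullet> i" x] eE E(1) by (metis subspace_scale)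
qed

text \<open>
  The class of \<open>D\<psi> x e\<close> is the velocity of the curve \<open>t \<mapsto> \<psi> (x + t e)\<close>; conversely the velocity of any
  curve lies in \<open>Y x\<close> by the preceding lemma, and since \<open>l\<close> is a line, the value of a homomorphism at
  one generator decides about all of its values.
\<close>

lemma proj_tangent_space_eq:
  assumes x: "x \<in> U'" "x \<in> E"
  shows "proj_tangent_space X (span {\<psi> x}) = quot_hom (span {\<psi> x}) (Y x)"
proof
  define l where "l = span {\<psi> x}"
  have sl: "subspace l" by (simp add: l_def)
  show "quot_hom (span {\<psi> x}) (Y x) \<subseteq> proj_tangent_space X (span {\<psi> x})"
    unfolding l_def[symmetric]
  proof
    fix h assume h: "h \<in> quot_hom l (Y x)"
    have "\<psi> x \<in> l" by (simp add: l_def span_base)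
    with h obtain w where "w \<in> Y x" "h (\<psi> x) = (+) w ` l"
      by (rule quot_hom_value)
    then obtain c e where ce: "e \<in> E" "h (\<psi> x) = (+) (c *\<^sub>R \<psi> x + D\<psi> x e) ` l"
      unfolding Y_def by blast
    have he: "h (\<psi> x) = (+) (D\<psi> x e) ` l"
      unfolding ce(2) by (rule coset_eqI[OF sl]) (simp add: l_def span_base span_scale)
    obtain \<epsilon> where \<epsilon>: "\<epsilon> > 0" "\<And>t. t \<in> {-\<epsilon><..<\<epsilon>} \<Longrightarrow> x + t *\<^sub>R e \<in> U'" "\<And>t. x + t *\<^sub>R e \<in> E"
      using line_in_slice[OF x ce(1)] by blast
    have "smooth_on {-\<epsilon><..<\<epsilon>} (\<lambda>t. \<psi> (x + t *\<^sub>R e))"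
      using smooth_\<psi> \<epsilon>(2) Ck_on_along_line[OF open_greaterThanLessThan, of "-\<epsilon>" \<epsilon> x e U' _ \<psi>]
      unfolding smooth_on_def by blast
    moreover have "\<forall>t\<in>{-\<epsilon><..<\<epsilon>}. \<psi> (x + t *\<^sub>R e) \<noteq> 0 \<and> span {\<psi> (x + t *\<^sub>R e)} \<in> X"
      using \<psi>_point(3,5)[OF \<epsilon>(2) \<epsilon>(3)] by simp
    moreover have "h \<in> quot_hom l UNIV" using h quot_hom_mono[OF subset_UNIV] by (rule rev_subsetD)
    ultimately show "h \<in> proj_tangent_space X l"
      unfolding proj_tangent_space_def using \<epsilon>(1) he
        vector_derivative_at[OF line_has_vector_derivative[OF x(1), of e]]
      by (intro CollectI conjI exI[of _ \<epsilon>] exI[of _ "\<lambda>t. \<psi> (x + t *\<^sub>R e)"]) (auto simp: l_def)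
  qed
  show "proj_tangent_space X (span {\<psi> x}) \<subseteq> quot_hom (span {\<psi> x}) (Y x)"
    unfolding l_def[symmetric]
  proof
    fix h assume "h \<in> proj_tangent_space X l"
    then obtain \<epsilon> \<gamma> where h: "h \<in> quot_hom l UNIV" and \<epsilon>: "\<epsilon> > 0"
      and sm: "smooth_on {-\<epsilon><..<\<epsilon>} \<gamma>"
      and \<gamma>X: "\<forall>t\<in>{-\<epsilon><..<\<epsilon>}. \<gamma> t \<noteq> 0 \<and> span {\<gamma> t} \<in> X" and \<gamma>0: "span {\<gamma> 0} = l"
      and h0: "h (\<gamma> 0) = (+) (vector_derivative \<gamma> (at 0)) ` l"
      unfolding proj_tangent_space_def by blast
    define g where "g = vector_derivative \<gamma> (at 0)"
    have "\<gamma> differentiable (at 0)"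
      using smooth_on_has_derivative[OF sm, of 0] \<epsilon> by (auto simp: differentiable_def)
    then have "(\<gamma> has_vector_derivative g) (at 0)"
      unfolding g_def using vector_derivative_works by blast
    moreover have "\<forall>\<^sub>F t in nhds 0. span {\<gamma> t} \<in> X"
      unfolding eventually_nhds using \<gamma>X \<epsilon> by (intro exI[of _ "{-\<epsilon><..<\<epsilon>}"]) auto
    ultimately have g: "g \<in> Y x"
      using lift_velocity_in_Y[OF x, of \<gamma> g] \<gamma>0 by (simp add: l_def)
    have gh: "g \<in> h (\<gamma> 0)"
      unfolding h0 g_def[symmetric] using imageI[OF subspace_0[OF sl], of "(+) g"] by simp
    have "h z \<in> (\<lambda>w. (+) w ` l) ` Y x" if z: "z \<in> l" for z
    proof -
      obtain a where a: "z = a *\<^sub>R \<gamma> 0" using z \<gamma>0 by (auto simp: span_singleton)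
      have "\<gamma> 0 \<in> l" using \<gamma>0 by (metis insertI1 span_base)
      then have "a *\<^sub>R g + 0 *\<^sub>R g \<in> h (a *\<^sub>R \<gamma> 0 + 0 *\<^sub>R \<gamma> 0)"
        using gh by (intro quot_hom_linear[OF h])
      then have "a *\<^sub>R g \<in> h z" by (simp add: a)
      moreover obtain w where w: "h z = (+) w ` l"
        using h z by (rule quot_hom_value)
      ultimately obtain q where q: "q \<in> l" "a *\<^sub>R g = w + q" by auto
      have "a *\<^sub>R g - q \<in> Y x"
        using g q(1) line_subset_Y[OF x(1)] subspace_Y[OF x(1)]
        by (auto simp: l_def intro: subspace_diff subspace_scale)
      then show ?thesis using w q by auto
    qed
    with h show "h \<in> quot_hom l (Y x)" by (rule quot_hom_restrict_codomain)
  qed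
qed

lemma tangent_fibre_eq:
  assumes x: "x \<in> U'" "x \<in> E"
  shows "tangent_fibre X (span {\<psi> x}) = Y x"
  unfolding tangent_fibre_def
proof (rule the_equality)
  show "subspace (Y x) \<and> span {\<psi> x} \<subseteq> Y x \<and>
      proj_tangent_space X (span {\<psi> x}) = quot_hom (span {\<psi> x}) (Y x)"
    using subspace_Y[OF x(1)] line_subset_Y[OF x(1)] proj_tangent_space_eq[OF x] by (intro conjI)
  fix Z assume Z: "subspace Z \<and> span {\<psi> x} \<subseteq> Z \<and>
      proj_tangent_space X (span {\<psi> x}) = quot_hom (span {\<psi> x}) Z"
  then have "quot_hom (span {\<psi> x}) Z = quot_hom (span {\<psi> x}) (Y x)"
    using proj_tangent_space_eq[OF x] by simp
  note Z = Z[THEN conjunct1] Z[THEN conjunct2, THEN conjunct1] this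
  show "Z = Y x"
  proof (rule equalityI)
    show "Z \<subseteq> Y x"
      using quot_hom_subset_imp_subset[OF \<psi>_point(2)[OF x] refl Z(1) subspace_Y[OF x(1)] line_subset_Y[OF x(1)]]
        Z(3) by simp
    show "Y x \<subseteq> Z"
      using quot_hom_subset_imp_subset[OF \<psi>_point(2)[OF x] refl subspace_Y[OF x(1)] Z(1) Z(2)] Z(3) by simp
  qed
qed

end

section \<open>The irregular locus has negligible cones\<close>

lemma line_normalized:
  assumes "l \<in> proj UNIV"
  obtains i p where "i \<in> Basis" "p \<bullet> i = 1" "l = span {p}"
proof -
  obtain v where v: "v \<noteq> 0" "l = span {v}" using assms by (rule proj_eq_span)
  then obtain i where i: "i \<in> Basis" "v \<bullet> i \<noteq> 0" using euclidean_all_zero_iff by blast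
  show thesis
  proof (rule that[OF i(1)])
    show "((1 / (v \<bullet> i)) *\<^sub>R v) \<bullet> i = 1" using i by simp
    show "l = span {(1 / (v \<bullet> i)) *\<^sub>R v}" using v i by (simp add: span_singleton_scaleR)
  qed
qed

lemma lift_chart_exists:
  assumes "proj_submanifold m X" "i \<in> Basis" "p \<bullet> i = 1" "span {p} \<in> X"
  obtains U U' E \<phi> \<psi> where "lift_chart X m i U U' E \<phi> \<psi>" "p \<in> U"
proof -
  have "linear (\<lambda>v. v \<bullet> i)" by (rule linearI) (simp_all add: inner_add_left)
  then have "smooth_submanifold m {v. v \<bullet> i = 1 \<and> span {v} \<in> X}"
    using assms(1) unfolding proj_submanifold_def by blast
  then have "\<exists>U U' E \<phi> \<psi>.
        open U \<and> p \<in> U \<and> open U' \<and>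
        homeomorphism U U' \<phi> \<psi> \<and> smooth_on U (\<phi> :: 'a \<Rightarrow> 'a) \<and> smooth_on U' (\<psi> :: 'a \<Rightarrow> 'a) \<and>
        subspace E \<and> dim E = m \<and> \<phi> ` (U \<inter> {v. v \<bullet> i = 1 \<and> span {v} \<in> X}) = U' \<inter> E"
    unfolding smooth_submanifold_def using assms(3,4) by blast
  then obtain U U' E \<phi> \<psi> where U: "open U" "p \<in> U" "open U'"
    "homeomorphism U U' \<phi> \<psi>" "smooth_on U (\<phi> :: 'a \<Rightarrow> 'a)" "smooth_on U' (\<psi> :: 'a \<Rightarrow> 'a)"
    "subspace E" "dim E = m" "\<phi> ` (U \<inter> {v. v \<bullet> i = 1 \<and> span {v} \<in> X}) = U' \<inter> E"
    by (elim exE conjE)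
  have "lift_chart X m i U U' E \<phi> \<psi>"
    by (rule lift_chart.intro) (use U assms(2) in simp_all)
  then show thesis using U(2) that by blast
qed

lemma line_in_chart:
  assumes "proj_submanifold m X" "l \<in> X"
  obtains i U U' E \<phi> \<psi> x
  where "lift_chart X m i U U' E \<phi> \<psi>" "x \<in> U'" "x \<in> E" "l = span {\<psi> x}"
proof -
  have "l \<in> proj UNIV" using assms unfolding proj_submanifold_def by blast
  then obtain i p where ip: "i \<in> Basis" "p \<bullet> i = 1" "l = span {p}" by (rule line_normalized)
  with assms obtain U U' E \<phi> \<psi> where c: "lift_chart X m i U U' E \<phi> \<psi>" "p \<in> U"
    using lift_chart_exists[of m X i p] by metis
  show thesis
    using that[OF c(1), of "\<phi> p"] lift_chart.\<phi>_point[OF c] ip assms(2) by simp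
qed

lemma countable_lift_charts:
  fixes X :: "'v::euclidean_space set set"
  assumes "proj_submanifold m X"
  obtains C :: "('v \<times> 'v set \<times> 'v set \<times> 'v set \<times> ('v \<Rightarrow> 'v) \<times> ('v \<Rightarrow> 'v)) set"
  where "countable C"
    "\<And>i U U' E \<phi> \<psi>. (i, U, U', E, \<phi>, \<psi>) \<in> C \<Longrightarrow> lift_chart X m i U U' E \<phi> \<psi>"
    "\<And>l. l \<in> X \<Longrightarrow> \<exists>i U U' E \<phi> \<psi>. (i, U, U', E, \<phi>, \<psi>) \<in> C \<and> (\<exists>x\<in>U' \<inter> E. l = span {\<psi> x})"
proof -
  define F where "F i = {U. \<exists>U' E \<phi> \<psi>. lift_chart X m i U U' E \<phi> \<psi>}" for i
  have "\<exists>G. G \<subseteq> F i \<and> countable G \<and> \<Union>G = \<Union>(F i)" for i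
  proof -
    have "open U" if "U \<in> F i" for U using that by (auto simp: F_def intro: lift_chart.open_U)
    then obtain G where "G \<subseteq> F i" "countable G" "\<Union>G = \<Union>(F i)" using Lindelof[of "F i"] by metis
    then show ?thesis by blast
  qed
  then obtain G where G: "\<And>i. G i \<subseteq> F i" "\<And>i. countable (G i)" "\<And>i. \<Union>(G i) = \<Union>(F i)"
    by metis
  have "\<forall>i U. \<exists>t. U \<in> F i \<longrightarrow> (case t of (U', E, \<phi>, \<psi>) \<Rightarrow> lift_chart X m i U U' E \<phi> \<psi>)"
    unfolding F_def by auto
  then obtain ch where ch: "\<And>i U. U \<in> F i \<Longrightarrow> (case ch i U of (U', E, \<phi>, \<psi>) \<Rightarrow> lift_chart X m i U U' E \<phi> \<psi>)"
    by metis
  define C where "C = (\<Union>i\<in>Basis. (\<lambda>U. (i, U, ch i U)) ` G i)"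
  show thesis
  proof (rule that[of C])
    show "countable C" unfolding C_def
      by (intro countable_UN countable_image G(2) countable_finite[OF finite_Basis])
    show chart: "lift_chart X m i U U' E \<phi> \<psi>" if "(i, U, U', E, \<phi>, \<psi>) \<in> C" for i U U' E \<phi> \<psi>
    proof -
      have "U \<in> F i" "ch i U = (U', E, \<phi>, \<psi>)" using that G(1) by (auto simp: C_def)
      then show ?thesis using ch[of U i] by simp
    qed
    fix l assume l: "l \<in> X"
    then have "l \<in> proj UNIV" using assms unfolding proj_submanifold_def by blast
    then obtain i p where ip: "i \<in> Basis" "p \<bullet> i = 1" "l = span {p}" by (rule line_normalized)
    then obtain U0 U0' E0 \<phi>0 \<psi>0 where "lift_chart X m i U0 U0' E0 \<phi>0 \<psi>0" "p \<in> U0"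
      using lift_chart_exists[OF assms, of i p] l by metis
    then have "p \<in> \<Union>(F i)" unfolding F_def by blast
    then obtain U where U: "U \<in> G i" "p \<in> U" using G(3) by blast
    obtain U' E \<phi> \<psi> where e: "ch i U = (U', E, \<phi>, \<psi>)" by (cases "ch i U") auto
    then have C: "(i, U, U', E, \<phi>, \<psi>) \<in> C" unfolding C_def using U(1) ip(1)
      by (intro UN_I[of i] image_eqI[of _ _ U]) simp_all
    have "span {p} \<in> X" using l ip(3) by simp
    note pt = lift_chart.\<phi>_point[OF chart[OF C] U(2) ip(2) this]
    then have "\<phi> p \<in> U' \<inter> E" "l = span {\<psi> (\<phi> p)}" using ip(3) by auto
    then show "\<exists>i U U' E \<phi> \<psi>. (i, U, U', E, \<phi>, \<psi>) \<in> C \<and> (\<exists>x\<in>U' \<inter> E. l = span {\<psi> x})"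
      using C by blast
  qed
qed

lemma differentiable_on_fst_compose:
  assumes "f differentiable_on A"
  shows "(\<lambda>z. f (fst z)) differentiable_on A \<times> B"
proof -
  have "f differentiable_on fst ` (A \<times> B)"
    using assms by (rule differentiable_on_subset) auto
  then show ?thesis
    by (rule differentiable_on_compose[of fst "A \<times> B" f, rotated])
      (rule bounded_linear_imp_differentiable_on[OF bounded_linear_fst])
qed

lemma differentiable_on_snd_compose:
  assumes "f differentiable_on B"
  shows "(\<lambda>z. f (snd z)) differentiable_on A \<times> B"
proof -
  have "f differentiable_on snd ` (A \<times> B)"
    using assms by (rule differentiable_on_subset) auto
  then show ?thesis
    by (rule differentiable_on_compose[of snd "A \<times> B" f, rotated])
      (rule bounded_linear_imp_differentiable_on[OF bounded_linear_snd])
qed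

lemma (in lift_chart) differentiable_on_\<psi>: "\<psi> differentiable_on U' \<inter> E"
  by (intro differentiable_at_imp_differentiable_on) (use D\<psi> in \<open>auto simp: differentiable_def\<close>)

text \<open>
  The secants through two charts: \<open>E \<times> E'\<close> has dimension \<open>2m\<close>, and subtracting from \<open>\<psi>' y\<close> its multiple
  of \<open>\<psi> x\<close> turns the pair into echelon form.
\<close>

lemma (in lift_chart) cone_negligible_two_points:
  assumes other: "lift_chart X m i' V V' E' \<phi>' \<psi>'" and j: "j \<in> Basis" "j \<noteq> i"
    and n: "DIM('w::euclidean_space) = m + 1"
  shows "cone_negligible {A :: 'w ^ 'v basis_index. \<exists>x\<in>U' \<inter> E. \<exists>y\<in>V' \<inter> E'.
    mat_app A (\<psi> x) = 0 \<and> mat_app A (\<psi>' y) = 0 \<and> (\<psi>' y - (\<psi>' y \<bullet> i) *\<^sub>R \<psi> x) \<bullet> j \<noteq> 0}"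
    (is "cone_negligible ?B")
proof -
  interpret other: lift_chart X m i' V V' E' \<phi>' \<psi>' by (rule other)
  define u where "u z = \<psi>' (snd z) - (\<psi>' (snd z) \<bullet> i) *\<^sub>R \<psi> (fst z)" for z
  define S where "S = {z \<in> (U' \<inter> E) \<times> (V' \<inter> E'). u z \<bullet> j \<noteq> 0}"
  have d1: "(\<lambda>z. \<psi> (fst z)) differentiable_on (U' \<inter> E) \<times> (V' \<inter> E')"
    using differentiable_on_fst_compose[OF differentiable_on_\<psi>] .
  have d2: "(\<lambda>z. \<psi>' (snd z)) differentiable_on (U' \<inter> E) \<times> (V' \<inter> E')"
    using differentiable_on_snd_compose[OF other.differentiable_on_\<psi>] .
  have d3: "(\<lambda>z. \<psi>' (snd z) \<bullet> i) differentiable_on (U' \<inter> E) \<times> (V' \<inter> E')"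
    by (rule differentiable_on_linear_compose[OF _ d2]) (auto intro!: linearI simp: inner_add_left)
  have d: "u differentiable_on (U' \<inter> E) \<times> (V' \<inter> E')"
    unfolding u_def by (intro differentiable_on_diff differentiable_on_scaleR d1 d2 d3)
  have "cone_negligible {A :: 'w ^ 'v basis_index. \<exists>z\<in>S. mat_app A (\<psi> (fst z)) = 0 \<and> mat_app A (u z) = 0}"
  proof (rule cone_negligible_kill_two_vectors)
    show "subspace (E \<times> E')" using E(1) other.E(1) by (rule subspace_Times)
    show "dim (E \<times> E') + 2 \<le> 2 * DIM('w)"
      using n E other.E by (simp add: dim_Times)
    show "S \<subseteq> E \<times> E'" unfolding S_def by auto
    have S: "S \<subseteq> (U' \<inter> E) \<times> (V' \<inter> E')" unfolding S_def by blast
    show "(\<lambda>z. \<psi> (fst z)) differentiable_on S" by (rule differentiable_on_subset[OF d1 S])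
    show "u differentiable_on S" by (rule differentiable_on_subset[OF d S])
    show "\<psi> (fst z) \<bullet> i = 1" if "z \<in> S" for z using that \<psi>_point(2) by (auto simp: S_def)
    then show "u z \<bullet> i = 0" if "z \<in> S" for z using that by (simp add: u_def inner_diff_left)
    show "u z \<bullet> j \<noteq> 0" if "z \<in> S" for z using that by (auto simp: S_def)
  qed (use i j in auto)
  moreover have "?B \<subseteq> {A. \<exists>z\<in>S. mat_app A (\<psi> (fst z)) = 0 \<and> mat_app A (u z) = 0}"
  proof clarify
    fix A :: "'w ^ 'v basis_index" and x y
    assume xy: "x \<in> U'" "x \<in> E" "y \<in> V'" "y \<in> E'" and A: "mat_app A (\<psi> x) = 0" "mat_app A (\<psi>' y) = 0"
      and nz: "(\<psi>' y - (\<psi>' y \<bullet> i) *\<^sub>R \<psi> x) \<bullet> j \<noteq> 0"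
    have "mat_app A (u (x, y)) = 0"
      using A by (simp add: u_def linear_diff[OF linear_mat_app] linear_scale[OF linear_mat_app])
    moreover have "(x, y) \<in> S" using xy nz by (simp add: S_def u_def)
    ultimately show "\<exists>z\<in>S. mat_app A (\<psi> (fst z)) = 0 \<and> mat_app A (u z) = 0"
      using A(1) by (intro bexI[of _ "(x, y)"]) auto
  qed
  ultimately show ?thesis by (rule cone_negligible_subset)
qed

text \<open>
  The tangents in one chart, with \<open>(x, e)\<close> in the \<open>2m\<close>-dimensional space \<open>E \<times> E\<close>; here the pair
  \<open>\<psi> x\<close>, \<open>D\<psi> x e\<close> is in echelon form from the start, by \<open>D\<psi>_inner_i\<close>.
\<close>

lemma (in lift_chart) cone_negligible_tangent_vector:
  assumes j: "j \<in> Basis" "j \<noteq> i" and n: "DIM('w::euclidean_space) = m + 1"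
  shows "cone_negligible {A :: 'w ^ 'v basis_index. \<exists>x\<in>U' \<inter> E. \<exists>e\<in>E.
    mat_app A (\<psi> x) = 0 \<and> mat_app A (D\<psi> x e) = 0 \<and> D\<psi> x e \<bullet> j \<noteq> 0}"
    (is "cone_negligible ?B")
proof -
  \<comment> \<open>Expanding \<open>e\<close> in the basis exhibits \<open>D\<psi> x e\<close> as differentiable in \<open>(x, e)\<close> jointly.\<close>
  define u where "u z = (\<Sum>b\<in>Basis. (snd z \<bullet> b) *\<^sub>R D\<psi> (fst z) b)" for z
  have u: "u (x, e) = D\<psi> x e" if "x \<in> U'" for x e
  proof -
    have "D\<psi> x e = D\<psi> x (\<Sum>b\<in>Basis. (e \<bullet> b) *\<^sub>R b)" by (simp only: euclidean_representation)
    also have "\<dots> = u (x, e)"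
      unfolding u_def fst_conv snd_conv
      by (simp only: linear_sum[OF linear_D\<psi>[OF that]] linear_scale[OF linear_D\<psi>[OF that]])
    finally show ?thesis by simp
  qed
  define S where "S = {z \<in> (U' \<inter> E) \<times> E. u z \<bullet> j \<noteq> 0}"
  have d1: "(\<lambda>z. \<psi> (fst z)) differentiable_on (U' \<inter> E) \<times> E"
    using differentiable_on_fst_compose[OF differentiable_on_\<psi>] .
  have "(\<lambda>x. D\<psi> x b) differentiable_on U' \<inter> E" for b
    using smooth_on_has_derivative[OF smooth_on_frechet_derivative[OF smooth_\<psi>]]
    by (intro differentiable_at_imp_differentiable_on) (auto simp: differentiable_def)
  then have d2: "(\<lambda>z. D\<psi> (fst z) b) differentiable_on (U' \<inter> E) \<times> E" for b
    by (rule differentiable_on_fst_compose)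
  have d3: "(\<lambda>z. snd z \<bullet> b) differentiable_on (U' \<inter> E) \<times> E" for b :: 'v
    by (rule differentiable_on_linear_compose[of "\<lambda>v. v \<bullet> b" snd])
      (auto intro!: linearI bounded_linear_imp_differentiable_on bounded_linear_snd simp: inner_add_left)
  have "(\<lambda>z. (snd z \<bullet> b) *\<^sub>R D\<psi> (fst z) b) differentiable_on (U' \<inter> E) \<times> E" for b
    by (intro differentiable_on_scaleR d2 d3)
  then have d: "u differentiable_on (U' \<inter> E) \<times> E"
    unfolding u_def differentiable_on_def by (intro ballI differentiable_sum) auto
  have "cone_negligible {A :: 'w ^ 'v basis_index. \<exists>z\<in>S. mat_app A (\<psi> (fst z)) = 0 \<and> mat_app A (u z) = 0}"
  proof (rule cone_negligible_kill_two_vectors)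
    show "subspace (E \<times> E)" using E(1) E(1) by (rule subspace_Times)
    show "dim (E \<times> E) + 2 \<le> 2 * DIM('w)"
      using n E by (simp add: dim_Times)
    show "S \<subseteq> E \<times> E" unfolding S_def by auto
    have S: "S \<subseteq> (U' \<inter> E) \<times> E" unfolding S_def by blast
    show "(\<lambda>z. \<psi> (fst z)) differentiable_on S" by (rule differentiable_on_subset[OF d1 S])
    show "u differentiable_on S" by (rule differentiable_on_subset[OF d S])
    show "\<psi> (fst z) \<bullet> i = 1" if "z \<in> S" for z using that \<psi>_point(2) by (auto simp: S_def)
    show "u z \<bullet> i = 0" if "z \<in> S" for z
      using that u D\<psi>_inner_i by (cases z) (auto simp: S_def)
    show "u z \<bullet> j \<noteq> 0" if "z \<in> S" for z using that by (auto simp: S_def)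
  qed (use i j in auto)
  moreover have "?B \<subseteq> {A. \<exists>z\<in>S. mat_app A (\<psi> (fst z)) = 0 \<and> mat_app A (u z) = 0}"
  proof clarify
    fix A :: "'w ^ 'v basis_index" and x e
    assume "x \<in> U'" "x \<in> E" "e \<in> E" "mat_app A (\<psi> x) = 0" "mat_app A (D\<psi> x e) = 0" "D\<psi> x e \<bullet> j \<noteq> 0"
    then show "\<exists>z\<in>S. mat_app A (\<psi> (fst z)) = 0 \<and> mat_app A (u z) = 0"
      by (intro bexI[of _ "(x, e)"]) (auto simp: S_def u)
  qed
  ultimately show ?thesis by (rule cone_negligible_subset)
qed

definition two_lines :: "'v::euclidean_space set set \<Rightarrow> ('v \<Rightarrow>\<^sub>L 'w::euclidean_space) set" where
  "two_lines X = {f. \<exists>l\<in>X. \<exists>l'\<in>X. l \<noteq> l' \<and> l \<subseteq> kernel f \<and> l' \<subseteq> kernel f}"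

definition tangent_line :: "'v::euclidean_space set set \<Rightarrow> ('v \<Rightarrow>\<^sub>L 'w::euclidean_space) set" where
  "tangent_line X = {f. \<exists>l\<in>X. l \<subseteq> kernel f \<and> (\<exists>u \<in> kernel f \<inter> tangent_fibre X l. u \<notin> l)}"

lemma span_subset_kernel: "span {p} \<subseteq> kernel f \<longleftrightarrow> blinfun_apply f p = 0"
proof
  show "blinfun_apply f p = 0" if "span {p} \<subseteq> kernel f"
    using that span_base[of p "{p}"] by (auto simp: kernel_def)
qed (auto simp: kernel_def span_singleton blinfun.scaleR_right)

lemma irregular_locus_eq:
  assumes "proj_submanifold m X"
  shows "irregular_locus X = (wall X \<inter> {f. \<not> surj (blinfun_apply f)}) \<union> two_lines X \<union> tangent_line X"
proof -
  have X: "X \<subseteq> proj UNIV" using assms unfolding proj_submanifold_def by blast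
  have sub: "l \<subseteq> tangent_fibre X l" if "l \<in> X" for l
  proof -
    obtain i U U' E \<phi> \<psi> x where c: "lift_chart X m i U U' E \<phi> \<psi>" "x \<in> U'" "x \<in> E" "l = span {\<psi> x}"
      using line_in_chart[OF assms \<open>l \<in> X\<close>] by metis
    interpret lift_chart X m i U U' E \<phi> \<psi> by (rule c)
    show ?thesis using c line_subset_Y tangent_fibre_eq by simp
  qed
  have ker: "l \<in> proj (kernel f) \<longleftrightarrow> l \<subseteq> kernel f" if "l \<in> X" for l and f :: "'a \<Rightarrow>\<^sub>L 'b"
    using X that by (auto simp: proj_def)
  have wall: "f \<in> wall X \<longleftrightarrow> (\<exists>l\<in>X. l \<subseteq> kernel f)" for f :: "'a \<Rightarrow>\<^sub>L 'b"
    using ker by (auto simp: wall_def)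
  have int: "X \<inter> proj (kernel f) = {\<xi>} \<longleftrightarrow> \<xi> \<in> X \<and> \<xi> \<subseteq> kernel f \<and> (\<forall>l\<in>X. l \<subseteq> kernel f \<longrightarrow> l = \<xi>)"
    for \<xi> and f :: "'a \<Rightarrow>\<^sub>L 'b"
    using ker by blast
  have ker_int: "kernel f \<inter> tangent_fibre X \<xi> = \<xi> \<longleftrightarrow> \<not> (\<exists>u \<in> kernel f \<inter> tangent_fibre X \<xi>. u \<notin> \<xi>)"
    if "\<xi> \<in> X" "\<xi> \<subseteq> kernel f" for \<xi> and f :: "'a \<Rightarrow>\<^sub>L 'b"
    using sub[OF that(1)] that(2) by blast
  show ?thesis
  proof (intro equalityI subsetI)
    fix f :: "'a \<Rightarrow>\<^sub>L 'b" assume f: "f \<in> irregular_locus X"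
    then obtain \<xi> where \<xi>: "\<xi> \<in> X" "\<xi> \<subseteq> kernel f" by (auto simp: irregular_locus_def wall)
    show "f \<in> (wall X \<inter> {f. \<not> surj (blinfun_apply f)}) \<union> two_lines X \<union> tangent_line X"
    proof (rule ccontr)
      assume neg: "f \<notin> (wall X \<inter> {f. \<not> surj (blinfun_apply f)}) \<union> two_lines X \<union> tangent_line X"
      have "X \<inter> proj (kernel f) = {\<xi>}" using neg \<xi> unfolding int two_lines_def by blast
      moreover have "kernel f \<inter> tangent_fibre X \<xi> = \<xi>"
        using neg \<xi> unfolding ker_int[OF \<xi>] tangent_line_def by blast
      moreover have "f \<in> wall X" "surj (blinfun_apply f)" using f neg by (auto simp: irregular_locus_def)
      ultimately have "f \<in> regular_wall X" unfolding regular_wall_def by blast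
      then show False using f by (simp add: irregular_locus_def)
    qed
  next
    fix f :: "'a \<Rightarrow>\<^sub>L 'b"
    assume f: "f \<in> (wall X \<inter> {f. \<not> surj (blinfun_apply f)}) \<union> two_lines X \<union> tangent_line X"
    then have "f \<in> wall X" by (auto simp: two_lines_def tangent_line_def wall)
    moreover have "f \<notin> regular_wall X"
    proof
      assume "f \<in> regular_wall X"
      then obtain \<xi> where s: "surj (blinfun_apply f)" and \<xi>: "X \<inter> proj (kernel f) = {\<xi>}"
        "kernel f \<inter> tangent_fibre X \<xi> = \<xi>"
        unfolding regular_wall_def by blast
      from \<xi>(1) have \<xi>': "\<xi> \<in> X" "\<xi> \<subseteq> kernel f" "\<And>l. l \<in> X \<Longrightarrow> l \<subseteq> kernel f \<Longrightarrow> l = \<xi>"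
        unfolding int by blast+
      have "f \<notin> two_lines X" using \<xi>'(3) unfolding two_lines_def by blast
      moreover have "f \<notin> tangent_line X" using \<xi>(2) \<xi>'(3) unfolding tangent_line_def by blast
      ultimately show False using f s by blast
    qed
    ultimately show "f \<in> irregular_locus X" by (simp add: irregular_locus_def)
  qed
qed

text \<open>
  Countably many charts cover \<open>X\<close>, and two independent vectors with pivot \<open>i\<close> in the first one have some
  second pivot \<open>j\<close>.  So countably many sets of the preceding three kinds cover the irregular locus.
\<close>

lemma cone_negligible_irregular_locus:
  fixes X :: "'v::euclidean_space set set"
  assumes X: "proj_submanifold m X" and n: "DIM('w::euclidean_space) = m + 1" "DIM('w) < DIM('v)"
  shows "cone_negligible (mat_hom -` (irregular_locus X :: ('v \<Rightarrow>\<^sub>L 'w) set))"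
proof -
  obtain C :: "('v \<times> 'v set \<times> 'v set \<times> 'v set \<times> ('v \<Rightarrow> 'v) \<times> ('v \<Rightarrow> 'v)) set"
    where C: "countable C"
    and chart: "\<And>i U U' E \<phi> \<psi>. (i, U, U', E, \<phi>, \<psi>) \<in> C \<Longrightarrow> lift_chart X m i U U' E \<phi> \<psi>"
    and cover: "\<And>l. l \<in> X \<Longrightarrow> \<exists>i U U' E \<phi> \<psi>. (i, U, U', E, \<phi>, \<psi>) \<in> C \<and> (\<exists>x\<in>U' \<inter> E. l = span {\<psi> x})"
    using countable_lift_charts[OF X] by metis
  define N where "N = {A :: 'w ^ 'v basis_index. \<not> surj (mat_app A)}"
  define B2 where "B2 = (\<lambda>((i, U :: 'v set, U' :: 'v set, E, \<phi> :: 'v \<Rightarrow> 'v, \<psi>), (i' :: 'v, V :: 'v set, V' :: 'v set, E', \<phi>' :: 'v \<Rightarrow> 'v, \<psi>'), j).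
    {A :: 'w ^ 'v basis_index. \<exists>x\<in>U' \<inter> E. \<exists>y\<in>V' \<inter> E'. mat_app A (\<psi> x) = 0 \<and> mat_app A (\<psi>' y) = 0 \<and>
      j \<noteq> i \<and> (\<psi>' y - (\<psi>' y \<bullet> i) *\<^sub>R \<psi> x) \<bullet> j \<noteq> 0})"
  define B1 where "B1 = (\<lambda>((i :: 'v, U :: 'v set, U' :: 'v set, E, \<phi> :: 'v \<Rightarrow> 'v, \<psi>), j).
    {A :: 'w ^ 'v basis_index. \<exists>x\<in>U' \<inter> E. \<exists>e\<in>E. mat_app A (\<psi> x) = 0 \<and>
      mat_app A (frechet_derivative \<psi> (at x) e) = 0 \<and> j \<noteq> i \<and> frechet_derivative \<psi> (at x) e \<bullet> j \<noteq> 0})"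
  have cN: "cone_negligible N" unfolding N_def by (rule cone_negligible_not_surj[OF n(2)])
  have empty: "cone_negligible ({} :: ('w ^ 'v basis_index) set)" by (simp add: cone_negligible_def)
  have c2: "cone_negligible (\<Union>t\<in>C \<times> C \<times> Basis. B2 t)"
  proof (rule cone_negligible_UN)
    show "countable (C \<times> C \<times> (Basis :: 'v set))" using C by (intro countable_SIGMA) (auto intro: countable_finite)
    fix t assume t: "t \<in> C \<times> C \<times> (Basis :: 'v set)"
    obtain i U U' E \<phi> \<psi> i' V V' E' \<phi>' \<psi>' j
      where te: "t = ((i, U, U', E, \<phi>, \<psi>), (i', V, V', E', \<phi>', \<psi>'), j)"
      by (cases t) auto
    show "cone_negligible (B2 t)"
    proof (cases "j = i")
      case True
      then show ?thesis using empty by (simp add: B2_def te)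
    next
      case False
      then show ?thesis
        using t lift_chart.cone_negligible_two_points[OF chart[of i U U' E \<phi> \<psi>] chart[of i' V V' E' \<phi>' \<psi>'] _ _ n(1), of j]
        by (simp add: te B2_def)
    qed
  qed
  have c1: "cone_negligible (\<Union>t\<in>C \<times> Basis. B1 t)"
  proof (rule cone_negligible_UN)
    show "countable (C \<times> (Basis :: 'v set))" using C by (intro countable_SIGMA) (auto intro: countable_finite)
    fix t assume t: "t \<in> C \<times> (Basis :: 'v set)"
    obtain i U U' E \<phi> \<psi> j where te: "t = ((i, U, U', E, \<phi>, \<psi>), j)"
      by (cases t) auto
    show "cone_negligible (B1 t)"
    proof (cases "j = i")
      case True
      then show ?thesis using empty by (simp add: B1_def te)
    next
      case False
      then show ?thesis
        using t lift_chart.cone_negligible_tangent_vector[OF chart[of i U U' E \<phi> \<psi>] _ _ n(1), of j]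
        by (simp add: te B1_def)
    qed
  qed
  have "cone_negligible (N \<union> (\<Union>t\<in>C \<times> C \<times> Basis. B2 t) \<union> (\<Union>t\<in>C \<times> Basis. B1 t))"
    by (intro cone_negligible_Un cN c1 c2)
  moreover have "mat_hom -` irregular_locus X \<subseteq> N \<union> (\<Union>t\<in>C \<times> C \<times> Basis. B2 t) \<union> (\<Union>t\<in>C \<times> Basis. B1 t)"
  proof
    fix A :: "'w ^ 'v basis_index" assume "A \<in> mat_hom -` irregular_locus X"
    then consider "\<not> surj (mat_app A)" | "mat_hom A \<in> two_lines X" | "mat_hom A \<in> tangent_line X"
      unfolding irregular_locus_eq[OF X] by auto
    then show "A \<in> N \<union> (\<Union>t\<in>C \<times> C \<times> Basis. B2 t) \<union> (\<Union>t\<in>C \<times> Basis. B1 t)"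
    proof cases
      case 1
      then show ?thesis by (simp add: N_def)
    next
      case 2
      then obtain l l' where l: "l \<in> X" "l' \<in> X" "l \<noteq> l'" "l \<subseteq> kernel (mat_hom A)" "l' \<subseteq> kernel (mat_hom A)"
        unfolding two_lines_def by blast
      obtain i U U' E \<phi> \<psi> x where c: "(i, U, U', E, \<phi>, \<psi>) \<in> C" "x \<in> U'" "x \<in> E" "l = span {\<psi> x}"
        using cover[OF l(1)] by blast
      obtain i' V V' E' \<phi>' \<psi>' y where c': "(i', V, V', E', \<phi>', \<psi>') \<in> C" "y \<in> V'" "y \<in> E'" "l' = span {\<psi>' y}"
        using cover[OF l(2)] by blast
      interpret lift_chart X m i U U' E \<phi> \<psi> by (rule chart[OF c(1)])
      interpret other: lift_chart X m i' V V' E' \<phi>' \<psi>' by (rule chart[OF c'(1)])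
      define w where "w = \<psi>' y - (\<psi>' y \<bullet> i) *\<^sub>R \<psi> x"
      have "w \<noteq> 0"
      proof
        assume "w = 0"
        then have e: "\<psi>' y = (\<psi>' y \<bullet> i) *\<^sub>R \<psi> x" by (simp add: w_def)
        then have "\<psi>' y \<bullet> i \<noteq> 0" using other.\<psi>_point(5)[OF c'(2,3)] by auto
        then have "span {\<psi>' y} = span {\<psi> x}" using e span_singleton_scaleR by metis
        then show False using l(3) c(4) c'(4) by simp
      qed
      then obtain j where j: "j \<in> Basis" "w \<bullet> j \<noteq> 0" using euclidean_all_zero_iff by blast
      have "w \<bullet> i = 0" using \<psi>_point(2)[OF c(2,3)] by (simp add: w_def inner_diff_left)
      then have "j \<noteq> i" using j by auto
      moreover have "mat_app A (\<psi> x) = 0" "mat_app A (\<psi>' y) = 0"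
        using l c c' by (simp_all add: span_subset_kernel)
      ultimately have "A \<in> B2 ((i, U, U', E, \<phi>, \<psi>), (i', V, V', E', \<phi>', \<psi>'), j)"
        unfolding B2_def using c c' j w_def by auto
      then show ?thesis using c(1) c'(1) j(1) by blast
    next
      case 3
      then obtain l u where l: "l \<in> X" "l \<subseteq> kernel (mat_hom A)" "u \<in> kernel (mat_hom A)"
        "u \<in> tangent_fibre X l" "u \<notin> l"
        unfolding tangent_line_def by blast
      obtain i U U' E \<phi> \<psi> x where c: "(i, U, U', E, \<phi>, \<psi>) \<in> C" "x \<in> U'" "x \<in> E" "l = span {\<psi> x}"
        using cover[OF l(1)] by blast
      interpret lift_chart X m i U U' E \<phi> \<psi> by (rule chart[OF c(1)])
      have A0: "mat_app A (\<psi> x) = 0" using l c by (simp add: span_subset_kernel)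
      have "u \<in> Y x" using l(4) c tangent_fibre_eq by simp
      then obtain a e where u: "e \<in> E" "u = a *\<^sub>R \<psi> x + D\<psi> x e" unfolding Y_def by blast
      have Ae: "mat_app A (D\<psi> x e) = 0"
        using l(3) A0 by (simp add: kernel_def u linear_add[OF linear_mat_app] linear_scale[OF linear_mat_app])
      have "D\<psi> x e \<noteq> 0" using l(5) u c(4) by (auto simp: span_base span_scale)
      then obtain j where j: "j \<in> Basis" "D\<psi> x e \<bullet> j \<noteq> 0" using euclidean_all_zero_iff by blast
      have "j \<noteq> i" using j D\<psi>_inner_i[OF c(2,3) u(1)] by auto
      then have "A \<in> B1 ((i, U, U', E, \<phi>, \<psi>), j)"
        unfolding B1_def using A0 Ae c u j by auto
      then show ?thesis using c(1) j(1) by blast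
    qed
  qed
  ultimately show ?thesis by (rule cone_negligible_subset)
qed

section \<open>The irregular locus is closed\<close>

text \<open>
  The content is that a compact set of lines is closed, that is the Hausdorff property of projective
  space.  For a unit vector \<open>v\<close> the function \<open>q\<close>, the squared cosine of the angle with \<open>v\<close>, descends
  to a continuous function \<open>g\<close> of lines that takes the value 1 at the line of \<open>v\<close> only.  If lines of \<open>X\<close>
  converge to this line, then 1 is a limit of values of \<open>g\<close> on \<open>X\<close>, and these values form a compact set.
\<close>

lemma compact_unit_vectors:
  fixes X :: "'v::euclidean_space set set"
  assumes X: "compactin proj_topology X"
  shows "compact {v. norm v = 1 \<and> span {v} \<in> X}"
proof -
  define K where "K = {v. norm v = 1 \<and> span {v} \<in> X}"
  have "closed K"
    unfolding closed_sequential_limits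
  proof (intro allI impI)
    fix s v assume s: "(\<forall>n. s n \<in> K) \<and> s \<longlonglongrightarrow> v"
    then have sv: "s \<longlonglongrightarrow> v" and sn: "\<And>n. norm (s n) = 1" "\<And>n. span {s n} \<in> X"
      by (auto simp: K_def)
    have "(\<lambda>n. norm (s n)) \<longlonglongrightarrow> norm v" using sv by (rule tendsto_norm)
    then have v: "norm v = 1" using sn(1) by (simp add: LIMSEQ_const_iff)
    then have vv: "v \<bullet> v = 1" by (simp add: norm_eq_1)
    define q where "q w = (w \<bullet> v)\<^sup>2 / (w \<bullet> w)" for w
    define g where "g l = q (SOME w. w \<noteq> 0 \<and> l = span {w})" for l
    have g: "g (span {w}) = q w" if w: "w \<noteq> 0" for w
    proof -
      define w' where "w' = (SOME w'. w' \<noteq> 0 \<and> span {w} = span {w'})"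
      have w': "w' \<noteq> 0 \<and> span {w} = span {w'}"
        unfolding w'_def by (rule someI[of _ w]) (use w in simp)
      then have "w \<in> span {w'}" by (metis insertI1 span_base)
      then obtain c where c: "w = c *\<^sub>R w'" by (auto simp: span_singleton)
      then have "c \<noteq> 0" using w by auto
      then have "q w = q w'" using w' by (simp add: q_def c power_mult_distrib power2_eq_square)
      then show ?thesis by (simp add: g_def w'_def)
    qed
    have "continuous_on (UNIV - {0}) q"
      unfolding q_def by (intro continuous_intros) auto
    then have "continuous_on (UNIV - {0}) (g \<circ> (\<lambda>w. span {w}))"
      by (rule continuous_on_eq) (use g in simp)
    then have "continuous_map proj_topology euclideanreal g"
      using continuous_compose_quotient_map[OF quotient_map_proj_topology, of euclideanreal g] by simp
    then have "compact (g ` X)"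
      using image_compactin[OF X \<open>continuous_map proj_topology euclideanreal g\<close>] by simp
    then have "closed (g ` X)" by (rule compact_imp_closed)
    moreover have "(\<lambda>n. g (span {s n})) \<longlonglongrightarrow> 1"
    proof -
      have "g (span {s n}) = (s n \<bullet> v)\<^sup>2" for n
      proof -
        have "s n \<noteq> 0" using sn(1)[of n] by auto
        moreover have "s n \<bullet> s n = 1" using sn(1)[of n] by (simp add: norm_eq_1)
        ultimately show ?thesis using g by (simp add: q_def)
      qed
      moreover have "(\<lambda>n. (s n \<bullet> v)\<^sup>2) \<longlonglongrightarrow> (v \<bullet> v)\<^sup>2" by (intro tendsto_intros sv)
      ultimately show ?thesis by (simp add: vv)
    qed
    ultimately have "1 \<in> g ` X"
      using closed_sequentially[of "g ` X" "\<lambda>n. g (span {s n})" 1] sn(2) by blast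
    then obtain l where l: "l \<in> X" "g l = 1" by auto
    then obtain w where w: "w \<noteq> 0" "l = span {w}"
      using compactin_subset_topspace[OF X] topspace_proj_topology by (metis proj_eq_span subsetD)
    then have "(w \<bullet> v)\<^sup>2 = w \<bullet> w" using l(2) g by (simp add: q_def field_simps)
    then have "(w - (w \<bullet> v) *\<^sub>R v) \<bullet> (w - (w \<bullet> v) *\<^sub>R v) = 0"
      by (simp add: inner_diff_left inner_diff_right vv power2_eq_square inner_commute)
    then have wv: "w = (w \<bullet> v) *\<^sub>R v" by simp
    then have "w \<bullet> v \<noteq> 0" using w(1) by auto
    then have "span {w} = span {v}" using wv span_singleton_scaleR by metis
    then show "v \<in> K" using v l(1) w(2) by (simp add: K_def)
  qed
  moreover have "bounded K" unfolding bounded_iff K_def by (intro exI[of _ 1]) auto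
  ultimately show ?thesis unfolding K_def by (simp add: compact_eq_bounded_closed)
qed

lemma unit_vector_of_line:
  assumes "l \<in> proj UNIV"
  obtains v where "norm v = 1" "l = span {v}"
proof -
  obtain w where w: "w \<noteq> 0" "l = span {w}" using assms by (rule proj_eq_span)
  show thesis
    by (rule that[of "(1 / norm w) *\<^sub>R w"]) (use w in \<open>simp_all add: span_singleton_scaleR\<close>)
qed

lemma convergent_subsequence_of_lines:
  fixes X :: "'v::euclidean_space set set" and f :: "'v \<Rightarrow>\<^sub>L 'w::euclidean_space"
  assumes X: "compactin proj_topology X" and l: "\<And>k. l k \<in> X" "\<And>k. l k \<subseteq> kernel (F k)" and F: "F \<longlonglongrightarrow> f"
  obtains r w v where "strict_mono (r :: nat \<Rightarrow> nat)" "(\<lambda>k. w (r k)) \<longlonglongrightarrow> v" "\<forall>k. l k = span {w k}"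
    "v \<noteq> 0" "span {v} \<in> X" "f v = 0"
proof -
  have "\<exists>w. norm w = 1 \<and> l k = span {w}" for k
    using unit_vector_of_line[of "l k"] l(1)[of k] compactin_subset_topspace[OF X]
    unfolding topspace_proj_topology by blast
  then obtain w where w: "\<And>k. norm (w k) = 1" "\<And>k. l k = span {w k}" by metis
  have "w k \<in> {v. norm v = 1 \<and> span {v} \<in> X}" for k
    using w(1)[of k] w(2)[of k] l(1)[of k] by simp
  then obtain v r where vr: "v \<in> {v. norm v = 1 \<and> span {v} \<in> X}" "strict_mono (r :: nat \<Rightarrow> nat)"
    "(w \<circ> r) \<longlonglongrightarrow> v"
    using seq_compactE[OF compact_unit_vectors[OF X, unfolded compact_eq_seq_compact_metric], of w] by blast
  have lim: "(\<lambda>k. w (r k)) \<longlonglongrightarrow> v" using vr(3) by (simp add: o_def)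
  have "(\<lambda>k. F (r k)) \<longlonglongrightarrow> f"
    using LIMSEQ_subseq_LIMSEQ[OF F vr(2)] by (simp add: o_def)
  then have "(\<lambda>k. F (r k) (w (r k))) \<longlonglongrightarrow> f v"
    using lim by (rule blinfun.tendsto)
  moreover have "F (r k) (w (r k)) = 0" for k
    using l(2)[of "r k"] w(2)[of "r k"] by (simp add: span_subset_kernel)
  ultimately have "f v = 0" by (simp add: LIMSEQ_const_iff)
  moreover have "v \<noteq> 0" "span {v} \<in> X" using vr(1) by auto
  ultimately show thesis using that[OF vr(2) lim _] w(2) by blast
qed

lemma closed_wall:
  fixes X :: "'v::euclidean_space set set"
  assumes "compactin proj_topology X"
  shows "closed (wall X :: ('v \<Rightarrow>\<^sub>L 'w::euclidean_space) set)"
  unfolding closed_sequential_limits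
proof (intro allI impI)
  fix F and f :: "'v \<Rightarrow>\<^sub>L 'w" assume F: "(\<forall>k. F k \<in> wall X) \<and> F \<longlonglongrightarrow> f"
  then have "\<forall>k. \<exists>l. l \<in> X \<and> l \<subseteq> kernel (F k)"
    unfolding wall_def proj_def by blast
  then obtain l where "\<And>k. l k \<in> X" "\<And>k. l k \<subseteq> kernel (F k)" by metis
  then obtain v where "v \<noteq> 0" "span {v} \<in> X" "f v = 0"
    using convergent_subsequence_of_lines[OF assms, of l F f] F by metis
  then have "span {v} \<in> X \<inter> proj (kernel f)"
    using span_in_proj[of v] span_subset_kernel[of v f] by (auto simp: proj_def)
  then show "f \<in> wall X" unfolding wall_def by blast
qed

lemma closed_not_surj: "closed {f :: 'v::euclidean_space \<Rightarrow>\<^sub>L 'w::euclidean_space. \<not> surj (blinfun_apply f)}"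
  unfolding closed_sequential_limits
proof (intro allI impI)
  have not_surj: "\<not> surj (blinfun_apply f) \<longleftrightarrow> (\<exists>w. norm w = 1 \<and> (\<forall>v. w \<bullet> f v = 0))"
    for f :: "'v \<Rightarrow>\<^sub>L 'w"
    by (intro not_surj_iff_orthogonal bounded_linear.linear blinfun.bounded_linear_right)
  fix F and f :: "'v \<Rightarrow>\<^sub>L 'w"
  assume F: "(\<forall>k. F k \<in> {f. \<not> surj (blinfun_apply f)}) \<and> F \<longlonglongrightarrow> f"
  then have "\<forall>k. \<exists>w. norm w = 1 \<and> (\<forall>v. w \<bullet> F k v = 0)"
    by (simp add: not_surj)
  then obtain w where w: "\<And>k. norm (w k) = 1" "\<And>k v. w k \<bullet> F k v = 0" by metis
  have "seq_compact (sphere 0 1 :: 'w set)"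
    using compact_sphere by (simp add: compact_eq_seq_compact_metric)
  moreover have "w k \<in> sphere 0 1" for k using w(1) by simp
  ultimately obtain w0 r where r: "w0 \<in> sphere 0 1" "strict_mono (r :: nat \<Rightarrow> nat)" "(w \<circ> r) \<longlonglongrightarrow> w0"
    using seq_compactE by metis
  have "w0 \<bullet> f v = 0" for v
  proof -
    have "(\<lambda>k. F (r k)) \<longlonglongrightarrow> f"
      using LIMSEQ_subseq_LIMSEQ[OF conjunct2[OF F] r(2)] by (simp add: o_def)
    then have "(\<lambda>k. w (r k) \<bullet> F (r k) v) \<longlonglongrightarrow> w0 \<bullet> f v"
      using r(3) unfolding o_def by (intro tendsto_inner blinfun.tendsto tendsto_const)
    then show ?thesis by (simp add: w(2) LIMSEQ_const_iff)
  qed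
  then show "f \<in> {f. \<not> surj (blinfun_apply f)}"
    using r(1) by (auto simp: not_surj)
qed

context lift_chart
begin

lemma tendsto_chart_point:
  assumes v: "v \<noteq> 0" "(1 / (v \<bullet> i)) *\<^sub>R v \<in> U" "v \<bullet> i \<noteq> 0"
    and w: "w \<longlonglongrightarrow> v" "\<And>k. span {w k} \<in> X"
  obtains x where "x \<longlonglongrightarrow> \<phi> ((1 / (v \<bullet> i)) *\<^sub>R v)"
    "\<forall>\<^sub>F k in sequentially. x k \<in> U' \<and> x k \<in> E \<and> span {w k} = span {\<psi> (x k)}"
proof -
  define p where "p k = (1 / (w k \<bullet> i)) *\<^sub>R w k" for k
  have wi: "(\<lambda>k. w k \<bullet> i) \<longlonglongrightarrow> v \<bullet> i" by (intro tendsto_intros w(1))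
  have p: "p \<longlonglongrightarrow> (1 / (v \<bullet> i)) *\<^sub>R v"
    unfolding p_def by (intro tendsto_intros wi w(1) v(3))
  have "continuous (at ((1 / (v \<bullet> i)) *\<^sub>R v)) \<phi>"
    using homeomorphism_cont1[OF homeo] open_U v(2) by (simp add: continuous_on_eq_continuous_at)
  then have 1: "(\<lambda>k. \<phi> (p k)) \<longlonglongrightarrow> \<phi> ((1 / (v \<bullet> i)) *\<^sub>R v)"
    using p by (rule isCont_tendsto_compose)
  have "\<forall>\<^sub>F k in sequentially. w k \<bullet> i \<noteq> 0" using wi v(3) by (rule tendsto_imp_eventually_ne)
  moreover have "\<forall>\<^sub>F k in sequentially. p k \<in> U" using p open_U v(2) by (rule topological_tendstoD)
  ultimately have 2: "\<forall>\<^sub>F k in sequentially. \<phi> (p k) \<in> U' \<and> \<phi> (p k) \<in> E \<and> span {w k} = span {\<psi> (\<phi> (p k))}"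
  proof eventually_elim
    case (elim k)
    have s: "span {p k} = span {w k}" unfolding p_def using elim(1) by (simp add: span_singleton_scaleR)
    have "p k \<bullet> i = 1" using elim(1) by (simp add: p_def)
    then show ?case using \<phi>_point[of "p k"] elim(2) w(2)[of k] s by simp
  qed
  show thesis by (rule that[OF 1 2])
qed

lemma D\<psi>_uniformly_close:
  assumes x: "x \<in> U'" and \<epsilon>: "\<epsilon> > 0"
  obtains \<delta> where "\<delta> > 0" "ball x \<delta> \<subseteq> U'"
    "\<And>y h. y \<in> ball x \<delta> \<Longrightarrow> norm (D\<psi> y h - D\<psi> x h) \<le> \<epsilon> * norm h"
proof -
  define \<epsilon>' where "\<epsilon>' = \<epsilon> / DIM('v)"
  have \<epsilon>': "\<epsilon>' > 0" using \<epsilon> by (simp add: \<epsilon>'_def)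
  have "\<forall>\<^sub>F y in nhds x. dist (D\<psi> y b) (D\<psi> x b) < \<epsilon>'" for b
  proof -
    have "continuous_on U' (\<lambda>y. D\<psi> y b)"
      using smooth_on_frechet_derivative[OF smooth_\<psi>, of b] unfolding smooth_on_def
      by (metis Ck_on.simps(1))
    then have "((\<lambda>y. D\<psi> y b) \<longlongrightarrow> D\<psi> x b) (nhds x)"
      using open_U' x by (simp add: continuous_on_eq_continuous_at continuous_at tendsto_nhds_iff)
    then show ?thesis using \<epsilon>' by (rule tendstoD)
  qed
  then have "\<forall>\<^sub>F y in nhds x. \<forall>b\<in>Basis. dist (D\<psi> y b) (D\<psi> x b) < \<epsilon>'"
    by (intro eventually_ball_finite) auto
  moreover have "\<forall>\<^sub>F y in nhds x. y \<in> U'" using open_U' x by (rule eventually_nhds_in_open)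
  ultimately have "\<forall>\<^sub>F y in nhds x. y \<in> U' \<and> (\<forall>b\<in>Basis. dist (D\<psi> y b) (D\<psi> x b) < \<epsilon>')"
    by eventually_elim blast
  then obtain \<delta> where \<delta>: "\<delta> > 0"
    and near: "\<And>y. dist y x < \<delta> \<Longrightarrow> y \<in> U' \<and> (\<forall>b\<in>Basis. dist (D\<psi> y b) (D\<psi> x b) < \<epsilon>')"
    unfolding eventually_nhds_metric by blast
  show thesis
  proof (rule that[OF \<delta>])
    show "ball x \<delta> \<subseteq> U'" using near by (auto simp: dist_commute)
    fix y h assume "y \<in> ball x \<delta>"
    then have y: "y \<in> U'" "\<And>b. b \<in> Basis \<Longrightarrow> norm (D\<psi> y b - D\<psi> x b) \<le> \<epsilon>'"
      using near[of y] by (auto simp: dist_norm norm_minus_commute intro!: less_imp_le)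
    have lin: "linear (\<lambda>h. D\<psi> y h - D\<psi> x h)"
      using linear_D\<psi>[OF y(1)] linear_D\<psi>[OF x] by (rule linear_compose_sub)
    have "D\<psi> y h - D\<psi> x h = (\<lambda>h. D\<psi> y h - D\<psi> x h) (\<Sum>b\<in>Basis. (h \<bullet> b) *\<^sub>R b)"
      by (simp only: euclidean_representation)
    also have "\<dots> = (\<Sum>b\<in>Basis. (h \<bullet> b) *\<^sub>R (D\<psi> y b - D\<psi> x b))"
      by (simp only: linear_sum[OF lin] linear_scale[OF lin])
    finally have "norm (D\<psi> y h - D\<psi> x h) = norm (\<Sum>b\<in>Basis. (h \<bullet> b) *\<^sub>R (D\<psi> y b - D\<psi> x b))"
      by (rule arg_cong)
    also have "\<dots> \<le> (\<Sum>b\<in>(Basis :: 'v set). norm h * \<epsilon>')"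
      by (rule sum_norm_le) (use y(2) \<epsilon>' in \<open>auto intro!: mult_mono Basis_le_norm\<close>)
    also have "\<dots> = \<epsilon> * norm h" by (simp add: \<epsilon>'_def)
    finally show "norm (D\<psi> y h - D\<psi> x h) \<le> \<epsilon> * norm h" .
  qed
qed

text \<open>
  On \<open>E\<close> the injective map \<open>f \<circ> D\<psi> x\<close> is bounded below by some \<open>c > 0\<close>.  A vector \<open>d\<close> within
  \<open>\<epsilon> |e|\<close> of \<open>D\<psi> x e\<close> and a map \<open>g\<close> close to \<open>f\<close> therefore satisfy \<open>g d \<noteq> 0\<close> unless \<open>e = 0\<close>.  Both
  conclusions are instances: \<open>d\<close> is a derivative \<open>D\<psi> y e\<close> at a nearby point, or the difference
  \<open>\<psi> y - \<psi> y'\<close> of two nearby points with \<open>e = y - y'\<close>, which the mean value inequality controls.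
\<close>

lemma immersion_stable:
  fixes f :: "'v \<Rightarrow>\<^sub>L 'w::euclidean_space"
  assumes x: "x \<in> U'" and inj: "\<And>e. e \<in> E \<Longrightarrow> f (D\<psi> x e) = 0 \<Longrightarrow> e = 0"
  obtains \<delta> where "\<delta> > 0"
    "\<forall>g y e. dist g f < \<delta> \<and> y \<in> ball x \<delta> \<and> e \<in> E \<and> blinfun_apply g (D\<psi> y e) = 0 \<longrightarrow> e = 0"
    "\<forall>g y y'. dist g f < \<delta> \<and> y \<in> ball x \<delta> \<inter> E \<and> y' \<in> ball x \<delta> \<inter> E \<and>
      blinfun_apply g (\<psi> y) = g (\<psi> y') \<longrightarrow> y = y'"
proof -
  have lin: "linear (D\<psi> x)" using linear_D\<psi>[OF x] .
  then have bl: "bounded_linear (\<lambda>e. f (D\<psi> x e))"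
    by (intro bounded_linear_compose[OF blinfun.bounded_linear_right]) (simp add: linear_conv_bounded_linear)
  obtain c where c: "c > 0" "\<And>e. e \<in> E \<Longrightarrow> norm (f (D\<psi> x e)) \<ge> c * norm e"
    using injective_imp_isometric[OF closed_subspace[OF E(1)] E(1) bl] inj by blast
  obtain L where L: "L > 0" "\<And>e. norm (D\<psi> x e) \<le> L * norm e"
    using linear_bounded_pos[OF lin] by blast
  \<comment> \<open>The constants are chosen so that replacing \<open>D\<psi> x e\<close> by \<open>d\<close> and \<open>f\<close> by \<open>g\<close> each cost at most
    \<open>c / 4 * norm e\<close>.\<close>
  define \<epsilon> where "\<epsilon> = c / (4 * (norm f + 1))"
  have \<epsilon>: "\<epsilon> > 0" using c by (auto simp: \<epsilon>_def intro!: divide_pos_pos add_nonneg_pos)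
  have f\<epsilon>: "norm f * \<epsilon> \<le> c / 4"
  proof -
    have "norm f * \<epsilon> \<le> (norm f + 1) * \<epsilon>" using \<epsilon> by (intro mult_right_mono) auto
    also have "\<dots> = c / 4" using norm_ge_zero[of f] by (simp add: \<epsilon>_def field_simps add_nonneg_eq_0_iff)
    finally show ?thesis .
  qed
  define \<delta>1 where "\<delta>1 = c / (4 * (L + \<epsilon>))"
  have \<delta>1: "\<delta>1 > 0" using c L \<epsilon> by (simp add: \<delta>1_def)
  have key: "e = 0" if g: "dist g f < \<delta>1" and e: "e \<in> E" and d: "norm (d - D\<psi> x e) \<le> \<epsilon> * norm e" and gd: "g d = 0"
    for g :: "'v \<Rightarrow>\<^sub>L 'w" and e d
  proof (rule ccontr)
    assume "e \<noteq> 0"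
    then have ne: "norm e > 0" by simp
    have "norm d \<le> norm (D\<psi> x e) + norm (d - D\<psi> x e)"
      using norm_triangle_ineq[of "D\<psi> x e" "d - D\<psi> x e"] by simp
    also have "\<dots> \<le> (L + \<epsilon>) * norm e" using L(2)[of e] d by (simp add: algebra_simps)
    finally have nd: "norm d \<le> (L + \<epsilon>) * norm e" .
    have "norm (f d) = norm ((f - g) d)" using gd by (simp add: blinfun.diff_left)
    also have "\<dots> \<le> norm (f - g) * norm d" by (rule norm_blinfun)
    also have "\<dots> \<le> \<delta>1 * ((L + \<epsilon>) * norm e)"
      using g nd \<delta>1 by (intro mult_mono) (auto simp: dist_norm norm_minus_commute)
    also have "\<dots> = c / 4 * norm e" using L(1) \<epsilon> by (simp add: \<delta>1_def field_simps)
    finally have 1: "norm (f d) \<le> c / 4 * norm e" .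
    have "norm (f (d - D\<psi> x e)) \<le> norm f * norm (d - D\<psi> x e)" by (rule norm_blinfun)
    also have "\<dots> \<le> norm f * (\<epsilon> * norm e)" using d by (rule mult_left_mono) simp
    also have "\<dots> \<le> c / 4 * norm e"
      using mult_right_mono[OF f\<epsilon>, of "norm e"] by (simp add: mult.assoc)
    finally have 2: "norm (f (d - D\<psi> x e)) \<le> c / 4 * norm e" .
    have "f (D\<psi> x e) = f d - f (d - D\<psi> x e)" by (simp add: blinfun.diff_right)
    then have "norm (f (D\<psi> x e)) \<le> norm (f d) + norm (f (d - D\<psi> x e))"
      using norm_triangle_ineq4[of "f d" "f (d - D\<psi> x e)"] by simp
    then have "c * norm e \<le> c / 2 * norm e" using 1 2 c(2)[OF e] by linarith
    then show False using ne c(1) by simp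
  qed
  obtain \<delta>2 where \<delta>2: "\<delta>2 > 0" "ball x \<delta>2 \<subseteq> U'"
    "\<And>y h. y \<in> ball x \<delta>2 \<Longrightarrow> norm (D\<psi> y h - D\<psi> x h) \<le> \<epsilon> * norm h"
    using D\<psi>_uniformly_close[OF x \<epsilon>] by blast
  have secant: "norm (\<psi> y - \<psi> y' - D\<psi> x (y - y')) \<le> \<epsilon> * norm (y - y')"
    if y: "y \<in> ball x \<delta>2" "y' \<in> ball x \<delta>2" for y y'
  proof -
    have "norm (\<psi> y - \<psi> y' - D\<psi> x (y - y')) \<le> norm (y - y') * \<epsilon>"
    proof (rule differentiable_bound_linearization[where S = "ball x \<delta>2" and f' = D\<psi> and ?x0.0 = x])
      show "y' + t *\<^sub>R (y - y') \<in> ball x \<delta>2" if "t \<in> {0..1}" for t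
        using convexD_alt[OF convex_ball y(2,1), of t] that by (simp add: algebra_simps)
      show "(\<psi> has_derivative D\<psi> z) (at z within ball x \<delta>2)" if "z \<in> ball x \<delta>2" for z
        using D\<psi> \<delta>2(2) that by (blast intro: has_derivative_at_withinI)
      show "onorm (D\<psi> z - D\<psi> x) \<le> \<epsilon>" if "z \<in> ball x \<delta>2" for z
        using \<delta>2(3)[OF that] \<epsilon> by (intro onorm_bound) auto
    qed (use \<delta>2(1) in simp)
    then show ?thesis by (simp add: mult.commute)
  qed
  show thesis
  proof (rule that[of "min \<delta>1 \<delta>2"]; (intro allI impI; elim conjE)?)
    show "min \<delta>1 \<delta>2 > 0" using \<delta>1 \<delta>2(1) by simp
  next
    fix g :: "'v \<Rightarrow>\<^sub>L 'w" and y e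
    assume "dist g f < min \<delta>1 \<delta>2" "y \<in> ball x (min \<delta>1 \<delta>2)" "e \<in> E" "g (D\<psi> y e) = 0"
    then show "e = 0" using key[of g e "D\<psi> y e"] \<delta>2(3)[of y e] by simp
  next
    fix g :: "'v \<Rightarrow>\<^sub>L 'w" and y y'
    assume g: "dist g f < min \<delta>1 \<delta>2" and y: "y \<in> ball x (min \<delta>1 \<delta>2) \<inter> E" "y' \<in> ball x (min \<delta>1 \<delta>2) \<inter> E"
      and gy: "g (\<psi> y) = g (\<psi> y')"
    have "y - y' = 0"
    proof (rule key)
      show "y - y' \<in> E" using y E(1) by (auto intro: subspace_diff)
      show "norm (\<psi> y - \<psi> y' - D\<psi> x (y - y')) \<le> \<epsilon> * norm (y - y')" using y by (intro secant) auto
      show "g (\<psi> y - \<psi> y') = 0" using gy by (simp add: blinfun.diff_right)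
    qed (use g in simp)
    then show "y = y'" by simp
  qed
qed

lemma not_tangent_line_injective:
  assumes x: "x \<in> U'" "x \<in> E" and f: "f \<notin> tangent_line X" "blinfun_apply f (\<psi> x) = 0"
    and e: "e \<in> E" "f (D\<psi> x e) = 0"
  shows "e = 0"
proof -
  have "D\<psi> x e \<in> tangent_fibre X (span {\<psi> x})"
    using tangent_fibre_eq[OF x] Y_I[OF e(1), of 0 x] by simp
  moreover have "D\<psi> x e \<in> kernel f" using e(2) by (simp add: kernel_def)
  moreover have "span {\<psi> x} \<subseteq> kernel f" using f(2) by (simp add: span_subset_kernel)
  ultimately have "D\<psi> x e \<in> span {\<psi> x}"
    using f(1) \<psi>_point(3)[OF x] unfolding tangent_line_def by blast
  then obtain c where c: "D\<psi> x e = c *\<^sub>R \<psi> x" by (auto simp: span_singleton)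
  then have "c = 0" using D\<psi>_inner_i[OF x e(1)] \<psi>_point(2)[OF x] by simp
  then show ?thesis using c D\<psi>_eq_0[OF x(1)] by simp
qed

lemma tangent_vector_in_kernel:
  assumes x: "x \<in> U'" "x \<in> E" and u: "u \<in> kernel f" "u \<in> tangent_fibre X (span {\<psi> x})" "u \<notin> span {\<psi> x}"
    and f: "blinfun_apply f (\<psi> x) = 0"
  obtains e where "e \<in> E" "e \<noteq> 0" "f (D\<psi> x e) = 0"
proof -
  obtain c e where e: "e \<in> E" "u = c *\<^sub>R \<psi> x + D\<psi> x e"
    using u(2) tangent_fibre_eq[OF x] unfolding Y_def by auto
  have "e \<noteq> 0" using u(3) e linear_0[OF linear_D\<psi>[OF x(1)]] by (auto simp: span_base span_scale)
  moreover have "f (D\<psi> x e) = 0"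
    using u(1) f by (simp add: kernel_def e blinfun.add_right blinfun.scaleR_right)
  ultimately show thesis using that e(1) by blast
qed

end

lemma chart_at_vector:
  assumes "proj_submanifold m X" "v \<noteq> 0" "span {v} \<in> X"
  obtains i U U' E \<phi> \<psi> where "lift_chart X m i U U' E \<phi> \<psi>" "v \<bullet> i \<noteq> 0" "(1 / (v \<bullet> i)) *\<^sub>R v \<in> U"
proof -
  obtain i where i: "i \<in> Basis" "v \<bullet> i \<noteq> 0" using assms(2) euclidean_all_zero_iff by blast
  have "((1 / (v \<bullet> i)) *\<^sub>R v) \<bullet> i = 1" "span {(1 / (v \<bullet> i)) *\<^sub>R v} \<in> X"
    using i assms(3) by (simp_all add: span_singleton_scaleR)
  then show thesis using lift_chart_exists[OF assms(1) i(1)] that i(2) by metis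
qed

text \<open>
  If \<open>f\<close> were not tangent to \<open>X\<close> at the limit line, then \<open>immersion_stable\<close> would exclude tangent
  vectors in the kernels of nearby maps at nearby lines.
\<close>

lemma closure_tangent_line:
  fixes X :: "'v::euclidean_space set set"
  assumes comp: "compactin proj_topology X" and X: "proj_submanifold m X"
  shows "closure (tangent_line X) \<subseteq> (tangent_line X :: ('v \<Rightarrow>\<^sub>L 'w::euclidean_space) set)"
proof
  fix f :: "'v \<Rightarrow>\<^sub>L 'w" assume "f \<in> closure (tangent_line X)"
  then obtain F where F: "\<And>k. F k \<in> tangent_line X" "F \<longlonglongrightarrow> f"
    unfolding closure_sequential by blast
  have "\<exists>l. l \<in> X \<and> l \<subseteq> kernel (F k) \<and> (\<exists>u. u \<in> kernel (F k) \<and> u \<in> tangent_fibre X l \<and> u \<notin> l)" for k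
    using F(1)[of k] unfolding tangent_line_def by blast
  then obtain l u where l: "\<And>k. l k \<in> X" "\<And>k. l k \<subseteq> kernel (F k)"
    "\<And>k. u k \<in> kernel (F k)" "\<And>k. u k \<in> tangent_fibre X (l k)" "\<And>k. u k \<notin> l k"
    by metis
  obtain r w v where r: "strict_mono (r :: nat \<Rightarrow> nat)" "(\<lambda>k. w (r k)) \<longlonglongrightarrow> v" "\<forall>k. l k = span {w k}"
    "v \<noteq> 0" "span {v} \<in> X" "f v = 0"
    by (rule convergent_subsequence_of_lines[OF comp l(1,2) F(2)])
  obtain i U U' E \<phi> \<psi> where "lift_chart X m i U U' E \<phi> \<psi>" and vi: "v \<bullet> i \<noteq> 0" "(1 / (v \<bullet> i)) *\<^sub>R v \<in> U"
    by (rule chart_at_vector[OF X r(4,5)])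
  then interpret lift_chart X m i U U' E \<phi> \<psi> by -
  define p where "p = (1 / (v \<bullet> i)) *\<^sub>R v"
  have p: "p \<in> U" "p \<bullet> i = 1" "span {p} \<in> X" "f p = 0"
    using vi r by (simp_all add: p_def span_singleton_scaleR blinfun.scaleR_right)
  note px = \<phi>_point[OF p(1-3)]
  show "f \<in> tangent_line X"
  proof (rule ccontr)
    assume nf: "f \<notin> tangent_line X"
    have inj: "e = 0" if "e \<in> E" "f (D\<psi> (\<phi> p) e) = 0" for e
      using not_tangent_line_injective[OF px(1,2) nf _ that] px(3) p(4) by simp
    obtain \<delta> where \<delta>: "\<delta> > 0"
      "\<forall>g y e. dist g f < \<delta> \<and> y \<in> ball (\<phi> p) \<delta> \<and> e \<in> E \<and> blinfun_apply g (D\<psi> y e) = 0 \<longrightarrow> e = 0"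
      by (rule immersion_stable[OF px(1) inj])
    have wX: "span {w (r k)} \<in> X" for k using l(1)[of "r k"] r(3) by simp
    obtain x where x: "x \<longlonglongrightarrow> \<phi> p"
      "\<forall>\<^sub>F k in sequentially. x k \<in> U' \<and> x k \<in> E \<and> span {w (r k)} = span {\<psi> (x k)}"
      by (rule tendsto_chart_point[OF r(4) vi(2,1) r(2) wX, folded p_def])
    have "\<forall>\<^sub>F k in sequentially. dist (F (r k)) f < \<delta>"
      using LIMSEQ_subseq_LIMSEQ[OF F(2) r(1)] \<delta>(1) by (auto simp: o_def dest: tendstoD)
    moreover have "\<forall>\<^sub>F k in sequentially. dist (x k) (\<phi> p) < \<delta>" using x(1) \<delta>(1) by (rule tendstoD)
    ultimately have "\<forall>\<^sub>F k in sequentially. False"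
      using x(2)
    proof eventually_elim
      case (elim k)
      then have xk: "x k \<in> U'" "x k \<in> E" and lk: "l (r k) = span {\<psi> (x k)}" using r(3) by auto
      have fk: "F (r k) (\<psi> (x k)) = 0" using l(2)[of "r k"] lk by (simp add: span_subset_kernel)
      obtain e where e: "e \<in> E" "e \<noteq> 0" "F (r k) (D\<psi> (x k) e) = 0"
        by (rule tangent_vector_in_kernel[OF xk l(3)[of "r k"] l(4,5)[of "r k", unfolded lk] fk])
      then show ?case using \<delta>(2)[rule_format, of "F (r k)" "x k" e] elim by (simp add: dist_commute)
    qed
    then show False by simp
  qed
qed

text \<open>
  Secants degenerate to tangents: when the two lines have the same limit, \<open>f\<close> is tangent there, since
  otherwise \<open>immersion_stable\<close> would make nearby maps injective on \<open>X\<close> near that line.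
\<close>

lemma closure_two_lines:
  fixes X :: "'v::euclidean_space set set"
  assumes comp: "compactin proj_topology X" and X: "proj_submanifold m X"
  shows "closure (two_lines X) \<subseteq> (two_lines X \<union> tangent_line X :: ('v \<Rightarrow>\<^sub>L 'w::euclidean_space) set)"
proof
  fix f :: "'v \<Rightarrow>\<^sub>L 'w" assume "f \<in> closure (two_lines X)"
  then obtain F where F: "\<And>k. F k \<in> two_lines X" "F \<longlonglongrightarrow> f"
    unfolding closure_sequential by blast
  have "\<exists>l l'. l \<in> X \<and> l \<subseteq> kernel (F k) \<and> l' \<in> X \<and> l' \<subseteq> kernel (F k) \<and> l \<noteq> l'" for k
    using F(1)[of k] unfolding two_lines_def by blast
  then obtain l l' where l: "\<And>k. l k \<in> X" "\<And>k. l k \<subseteq> kernel (F k)"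
    and l': "\<And>k. l' k \<in> X" "\<And>k. l' k \<subseteq> kernel (F k)" and ne: "\<And>k. l k \<noteq> l' k"
    by metis
  obtain r w v where r: "strict_mono (r :: nat \<Rightarrow> nat)" "(\<lambda>k. w (r k)) \<longlonglongrightarrow> v" "\<forall>k. l k = span {w k}"
    "v \<noteq> 0" "span {v} \<in> X" "f v = 0"
    by (rule convergent_subsequence_of_lines[OF comp l F(2)])
  have Fr: "(\<lambda>k. F (r k)) \<longlonglongrightarrow> f" using LIMSEQ_subseq_LIMSEQ[OF F(2) r(1)] by (simp add: o_def)
  obtain r' w' v' where r': "strict_mono (r' :: nat \<Rightarrow> nat)" "(\<lambda>k. w' (r' k)) \<longlonglongrightarrow> v'" "\<forall>k. l' (r k) = span {w' k}"
    "v' \<noteq> 0" "span {v'} \<in> X" "f v' = 0"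
    by (rule convergent_subsequence_of_lines[OF comp l'(1) l'(2) Fr])
  have wr: "(\<lambda>k. w (r (r' k))) \<longlonglongrightarrow> v" using LIMSEQ_subseq_LIMSEQ[OF r(2) r'(1)] by (simp add: o_def)
  have Frr: "(\<lambda>k. F (r (r' k))) \<longlonglongrightarrow> f" using LIMSEQ_subseq_LIMSEQ[OF Fr r'(1)] by (simp add: o_def)
  show "f \<in> two_lines X \<union> tangent_line X"
  proof (cases "span {v} = span {v'}")
    case False
    then have "f \<in> two_lines X"
      unfolding two_lines_def using r(5,6) r'(5,6) span_subset_kernel[of _ f] by blast
    then show ?thesis by simp
  next
    case True
    obtain i U U' E \<phi> \<psi> where "lift_chart X m i U U' E \<phi> \<psi>" and vi: "v \<bullet> i \<noteq> 0" "(1 / (v \<bullet> i)) *\<^sub>R v \<in> U"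
      by (rule chart_at_vector[OF X r(4,5)])
    then interpret lift_chart X m i U U' E \<phi> \<psi> by -
    define p where "p = (1 / (v \<bullet> i)) *\<^sub>R v"
    have p: "p \<in> U" "p \<bullet> i = 1" "span {p} \<in> X" "f p = 0"
      using vi r by (simp_all add: p_def span_singleton_scaleR blinfun.scaleR_right)
    note px = \<phi>_point[OF p(1-3)]
    have "v' \<in> span {v}" using True by (simp add: span_base)
    then obtain c where c: "v' = c *\<^sub>R v" by (auto simp: span_singleton)
    then have "c \<noteq> 0" using r'(4) by auto
    then have vi': "v' \<bullet> i \<noteq> 0" "(1 / (v' \<bullet> i)) *\<^sub>R v' = p"
      using vi(1) by (simp_all add: c p_def)
    have "f \<in> tangent_line X"
    proof (rule ccontr)
      assume nf: "f \<notin> tangent_line X"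
      have inj: "e = 0" if "e \<in> E" "f (D\<psi> (\<phi> p) e) = 0" for e
      proof (rule not_tangent_line_injective[OF px(1,2) nf _ that])
        show "f (\<psi> (\<phi> p)) = 0" by (simp only: px(3) p(4))
      qed
      obtain \<delta> where \<delta>: "\<delta> > 0"
        "\<forall>g y y'. dist g f < \<delta> \<and> y \<in> ball (\<phi> p) \<delta> \<inter> E \<and> y' \<in> ball (\<phi> p) \<delta> \<inter> E \<and>
          blinfun_apply g (\<psi> y) = g (\<psi> y') \<longrightarrow> y = y'"
        by (rule immersion_stable[OF px(1) inj])
      have wX: "span {w (r (r' k))} \<in> X" "span {w' (r' k)} \<in> X" for k
        using l(1)[of "r (r' k)"] l'(1)[of "r (r' k)"] r(3) r'(3) by simp_all
      obtain x where x: "x \<longlonglongrightarrow> \<phi> p"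
        "\<forall>\<^sub>F k in sequentially. x k \<in> U' \<and> x k \<in> E \<and> span {w (r (r' k))} = span {\<psi> (x k)}"
        by (rule tendsto_chart_point[OF r(4) vi(2,1) wr wX(1), folded p_def])
      obtain x' where x': "x' \<longlonglongrightarrow> \<phi> p"
        "\<forall>\<^sub>F k in sequentially. x' k \<in> U' \<and> x' k \<in> E \<and> span {w' (r' k)} = span {\<psi> (x' k)}"
        by (rule tendsto_chart_point[OF r'(4) _ vi'(1) r'(2) wX(2), unfolded vi'(2), OF p(1)])
      have "\<forall>\<^sub>F k in sequentially. dist (F (r (r' k))) f < \<delta>" using Frr \<delta>(1) by (rule tendstoD)
      moreover have "\<forall>\<^sub>F k in sequentially. dist (x k) (\<phi> p) < \<delta>" using x(1) \<delta>(1) by (rule tendstoD)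
      moreover have "\<forall>\<^sub>F k in sequentially. dist (x' k) (\<phi> p) < \<delta>" using x'(1) \<delta>(1) by (rule tendstoD)
      ultimately have "\<forall>\<^sub>F k in sequentially. False"
        using x(2) x'(2)
      proof eventually_elim
        case (elim k)
        define g where "g = F (r (r' k))"
        have lk: "l (r (r' k)) = span {\<psi> (x k)}" "l' (r (r' k)) = span {\<psi> (x' k)}"
          using elim r(3) r'(3) by auto
        have "g (\<psi> (x k)) = 0" "g (\<psi> (x' k)) = 0"
          using l(2)[of "r (r' k)"] l'(2)[of "r (r' k)"] lk by (simp_all add: g_def span_subset_kernel)
        then have "x k = x' k"
          using \<delta>(2)[rule_format, of g "x k" "x' k"] elim by (simp add: dist_commute g_def)
        then show ?case using lk ne[of "r (r' k)"] by simp
      qed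
      then show False by simp
    qed
    then show ?thesis by simp
  qed
qed

lemma closed_irregular_locus:
  fixes X :: "'v::euclidean_space set set"
  assumes "compactin proj_topology X" and "proj_submanifold m X"
  shows "closed (irregular_locus X :: ('v \<Rightarrow>\<^sub>L 'w::euclidean_space) set)"
proof -
  have "closure (two_lines X \<union> tangent_line X) \<subseteq> (two_lines X \<union> tangent_line X :: ('v \<Rightarrow>\<^sub>L 'w) set)"
    using closure_two_lines[OF assms] closure_tangent_line[OF assms] by (auto simp: closure_Un)
  then have "closed (two_lines X \<union> tangent_line X :: ('v \<Rightarrow>\<^sub>L 'w) set)"
    using closure_subset_eq by blast
  then show ?thesis
    unfolding irregular_locus_eq[OF assms(2)] Un_assoc
    by (intro closed_Un[OF closed_Int] closed_wall[OF assms(1)] closed_not_surj)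
qed

section \<open>The complement of the irregular locus\<close>

theorem theorem2p17:
  fixes X :: "'v::euclidean_space set set"
    and N m n :: nat
  assumes "DIM('v) = N"
    and "compactin proj_topology X"
    and "proj_submanifold m X"
    and "m < N - 1"
    and "n = m + 1"
    and "DIM('w::euclidean_space) = n"
  shows "closed (irregular_locus X :: ('v \<Rightarrow>\<^sub>L 'w) set) \<and>
         connected (UNIV - (irregular_locus X :: ('v \<Rightarrow>\<^sub>L 'w) set))"
proof
  show "closed (irregular_locus X :: ('v \<Rightarrow>\<^sub>L 'w) set)"
    using assms(2,3) by (rule closed_irregular_locus)
  have "DIM('w) = m + 1" "DIM('w) < DIM('v)" using assms by simp_all
  then show "connected (UNIV - (irregular_locus X :: ('v \<Rightarrow>\<^sub>L 'w) set))"
    by (intro connected_complement_hom cone_negligible_irregular_locus[OF assms(3)])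
qed

end
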